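(* Let $G$ be a finite group acting on a Lie-Yamaguti algebra $(L,[\cdot,\cdot],\{\cdot,\cdot,\cdot\})$ over $\mathbb{K}$, and suppose $H_G^2(L,L)\times H_G^3(L,L)=0$. Then $L$ is an equivariantly rigid Lie-Yamaguti algebra, i.e. every equivariant 1-parameter formal deformation of $L$ is equivalent (as an equivariant deformation) to the null equivariant deformation $([\cdot,\cdot],\{\cdot,\cdot,\cdot\})$.
   Context: $\mathbb{K}$ is an algebraically closed field of characteristic different from 2 and 3. **Lie-Yamaguti algebra.** A $\mathbb{K}$-vector space $L$ with a bilinear operation $[\cdot,\cdot]$ and a trilinear operation $\{\cdot,\cdot,\cdot\}$ such that for all $x,y,z,u,v,w\in L$ (where $\circlearrowleft_{(x,y,z)}$ denotes the sum over cyclic permutations of $x,y,z$): (LY1) $[x,y]=-[y,x]$; (LY2) $\{x,y,z\}=-\{y,x,z\}$; (LY3) $\circlearrowleft_{(x,y,z)}([[x,y],z]+\{x,y,z\})=0$; (LY4) $\circlearrowleft_{(x,y,z)}\{[x,y],z,u\}=0$; (LY5) $\{x,y,[u,v]\}=[\{x,y,u\},v]+[u,\{x,y,v\}]$; (LY6) $\{x,y,\{u,v,w\}\}=\{\{x,y,u\},v,w\}+\{u,\{x,y,v\},w\}+\{u,v,\{x,y,w\}\}$. The same definition is used over $\mathbb{K}[[t]]$ (with $\mathbb{K}[[t]]$-multilinear operations). **Group action.** A finite group $G$ acts on $L$ if there is a map $G\times L\to L$, $(\sigma,a)\mapsto\sigma a$, such that each $a\mapsto\sigma a$ is linear, $ea=a$,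 $\sigma(\tau a)=(\sigma\tau)a$, $\sigma[a,b]=[\sigma a,\sigma b]$ and $\sigma\{a,b,c\}=\{\sigma a,\sigma b,\sigma c\}$ for all $\sigma,\tau\in G$, $a,b,c\in L$. **Equivariant formal deformations.** $L[[t]]$ is the $\mathbb{K}[[t]]$-module of formal power series with coefficients in $L$. An equivariant 1-parameter formal deformation of $L$ is a pair $(f_t,g_t)$, $f_t=\sum_{i\ge0}f_it^i$, $g_t=\sum_{i\ge0}g_it^i$, with $f_0=[\cdot,\cdot]$, $g_0=\{\cdot,\cdot,\cdot\}$, each $f_i:L\times L\to L$ $\mathbb{K}$-bilinear and each $g_i:L\times L\times L\to L$ $\mathbb{K}$-trilinear (extended $\mathbb{K}[[t]]$-multilinearly to $L[[t]]$), such that $(L[[t]],f_t,g_t)$ is a Lie-Yamaguti algebra over $\mathbb{K}[[t]]$ and $f_i(\sigma a,\sigma b)=\sigma f_i(a,b)$, $g_i(\sigma a,\sigma b,\sigma c)=\sigma g_i(a,b,c)$ for all $a,b,c\in L$, $\sigma\in G$, $i\ge1$. The null equivariant deformation is $(f_t,g_t)=(f_0,g_0)$. **Equivalence.** Equivariant deformations $(f_t,g_t)$ and $(f'_t,g'_t)$ are equivalent if there is a formal isomorphism of $\mathbb{K}[[t]]$-modules $\phi_t=\sum_{i\ge0}\phi_it^i:L[[t]]\to L[[t]]$, with each $\phi_i:L\to L$ $\mathbb{K}$-linear (extended $\mathbb{K}[[t]]$-linearly), $\phi_0=\mathrm{id}_L$, $\phi_i(\sigma x)=\sigma\phi_i(x)$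 for all $i\ge0$, $\sigma\in G$, $x\in L$, such that $\phi_t(f_t(x,y))=f'_t(\phi_t(x),\phi_t(y))$ and $\phi_t(g_t(x,y,z))=g'_t(\phi_t(x),\phi_t(y),\phi_t(z))$. An equivariant deformation is trivial if it is equivalent to the null one; $L$ is (analytically) equivariantly rigid if every equivariant 1-parameter formal deformation of $L$ is trivial. **Equivariant cohomology (adjoint coefficients).** $C^n(L,L)$ is the space of $n$-linear maps $f:L^n\to L$ with $f(x_1,\dots,x_n)=0$ whenever $x_{2i-1}=x_{2i}$ for some $i$ with $2i\le n$, and $C_G^n(L,L)=\{f\in C^n(L,L): f(\sigma x_1,\dots,\sigma x_n)=\sigma f(x_1,\dots,x_n)\ \forall\sigma\in G, x_i\in L\}$. For $h\in C^1(L,L)$: $\delta^1_Ih(x,y)=[x,h(y)]-[y,h(x)]-h([x,y])$, $\delta^1_{II}h(x,y,z)=\{h(x),y,z\}-\{h(y),x,z\}+\{x,y,h(z)\}-h(\{x,y,z\})$. For $(f,g)\in C^2(L,L)\times C^3(L,L)$, $\delta(f,g)=(\delta_If,\delta_{II}g)$, where $(\delta_If)(x_1,\dots,x_4)=[x_3,g(x_1,x_2,x_4)]-[x_4,g(x_1,x_2,x_3)]-g(x_1,x_2,[x_3,x_4])-\{x_1,x_2,f(x_3,x_4)\}+f(\{x_1,x_2,x_3\},x_4)+f(x_3,\{x_1,x_2,x_4\})$ (this depends on both $f$ and $g$), $(\delta_{II}g)(x_1,\dots,x_5)=\{g(x_1,x_2,x_3),x_4,x_5\}-\{g(x_1,x_2,x_4),x_3,x_5\}-\{x_1,x_2,g(x_3,x_4,x_5)\}+\{x_3,x_4,g(x_1,x_2,x_5)\}+g(\{x_1,x_2,x_3\},x_4,x_5)+g(x_3,\{x_1,x_2,x_4\},x_5)+g(x_3,x_4,\{x_1,x_2,x_5\})-g(x_1,x_2,\{x_3,x_4,x_5\})$.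 Set $Z_G^2(L,L)\times Z_G^3(L,L):=\{(f,g)\in C_G^2(L,L)\times C_G^3(L,L):\delta(f,g)=(0,0)\}$, $B_G^2(L,L)\times B_G^3(L,L):=\{(\delta^1_Ih,\delta^1_{II}h):h\in C_G^1(L,L)\}$, and $H_G^2(L,L)\times H_G^3(L,L):=(Z_G^2(L,L)\times Z_G^3(L,L))/(B_G^2(L,L)\times B_G^3(L,L))$. The product symbols here are notation for a single subspace of $C_G^2\times C_G^3$ and a single quotient space. *)

theory Defs
  imports
    "HOL-Algebra.Group"
    "HOL-Computational_Algebra.Polynomial"
    "HOL-Computational_Algebra.Formal_Power_Series"
    "HOL-Library.Function_Algebras"
    "HOL-Library.Product_Plus"
begin

section \<open>Lie-Yamaguti algebras\<close>

definition bilinear_op ::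
  "('r::comm_ring_1 \<Rightarrow> 'l::ab_group_add \<Rightarrow> 'l) \<Rightarrow> ('l \<Rightarrow> 'l \<Rightarrow> 'l) \<Rightarrow> bool" where
  "bilinear_op s f \<longleftrightarrow>
     (\<forall>y. module_hom s s (\<lambda>x. f x y)) \<and>
     (\<forall>x. module_hom s s (\<lambda>y. f x y))"

definition trilinear_op ::
  "('r::comm_ring_1 \<Rightarrow> 'l::ab_group_add \<Rightarrow> 'l) \<Rightarrow> ('l \<Rightarrow> 'l \<Rightarrow> 'l \<Rightarrow> 'l) \<Rightarrow> bool" where
  "trilinear_op s g \<longleftrightarrow>
     (\<forall>y z. module_hom s s (\<lambda>x. g x y z)) \<and>
     (\<forall>x z. module_hom s s (\<lambda>y. g x y z)) \<and>
     (\<forall>x y. module_hom s s (\<lambda>z. g x y z))"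

text \<open>The scalars form a commutative ring, so that the locale applies both to a vector space
  over a field \<open>K\<close> and to a module over \<open>K[[t]]\<close>. The operation \<open>br x y\<close> is \<open>[x, y]\<close> and
  \<open>tr x y z\<close> is \<open>{x, y, z}\<close>.\<close>

locale lie_yamaguti = module scale
  for scale :: "'r::comm_ring_1 \<Rightarrow> 'l::ab_group_add \<Rightarrow> 'l" +
  fixes br :: "'l \<Rightarrow> 'l \<Rightarrow> 'l"
    and tr :: "'l \<Rightarrow> 'l \<Rightarrow> 'l \<Rightarrow> 'l"
  assumes br_bilinear: "bilinear_op scale br"
    and tr_trilinear: "trilinear_op scale tr"
    and LY1: "br x y = - br y x"
    and LY2: "tr x y z = - tr y x z"
    and LY3: "(br (br x y) z + tr x y z) + (br (br y z) x + tr y z x)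
                + (br (br z x) y + tr z x y) = 0"
    and LY4: "tr (br x y) z u + tr (br y z) x u + tr (br z x) y u = 0"
    and LY5: "tr x y (br u v) = br (tr x y u) v + br u (tr x y v)"
    and LY6: "tr x y (tr u v w) = tr (tr x y u) v w + tr u (tr x y v) w + tr u v (tr x y w)"

section \<open>Formal power series with coefficients in a module\<close>

text \<open>\<open>L[[t]]\<close> is the type \<open>'l fps\<close>, whose additive structure needs no multiplication on \<open>'l\<close>.\<close>

definition fps_scale ::
  "('k::comm_ring_1 \<Rightarrow> 'l::ab_group_add \<Rightarrow> 'l) \<Rightarrow> 'k fps \<Rightarrow> 'l fps \<Rightarrow> 'l fps" where
  "fps_scale s c x = Abs_fps (\<lambda>n. \<Sum>i\<le>n. s (fps_nth c i) (fps_nth x (n - i)))"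

lemma module_fps_scale:
  assumes "module s" shows "module (fps_scale s)"
proof -
  interpret module s by fact
  show ?thesis
  proof
    fix a b :: "'a fps" and x y :: "'b fps"
    show "fps_scale s a (x + y) = fps_scale s a x + fps_scale s a y"
      by (simp add: fps_eq_iff fps_scale_def scale_right_distrib sum.distrib)
    show "fps_scale s (a + b) x = fps_scale s a x + fps_scale s b x"
      by (simp add: fps_eq_iff fps_scale_def scale_left_distrib sum.distrib)
    show "fps_scale s 1 x = x"
    proof (rule fps_ext)
      fix n
      have "(\<Sum>i\<le>n. s (fps_nth 1 i) (fps_nth x (n - i))) = (\<Sum>i\<le>n. if i = 0 then fps_nth x n else 0)"
        by (rule sum.cong) auto
      then show "fps_nth (fps_scale s 1 x) n = fps_nth x n" by (simp add: fps_scale_def)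
    qed
    show "fps_scale s a (fps_scale s b x) = fps_scale s (a * b) x"
    proof (rule fps_ext)
      fix n
      have "fps_nth (fps_scale s a (fps_scale s b x)) n =
        (\<Sum>j=0..n. \<Sum>i=0..n - j. s (fps_nth a j * fps_nth b i) (fps_nth x (n - j - i)))"
        by (simp add: fps_scale_def scale_sum_right atMost_atLeast0)
      also have "\<dots> = (\<Sum>j=0..n. \<Sum>i=0..j. s (fps_nth a i * fps_nth b (j - i)) (fps_nth x (n - j)))"
        by (rule fps_mult_assoc_lemma[symmetric])
      also have "\<dots> = fps_nth (fps_scale s (a * b) x) n"
        by (simp add: fps_scale_def fps_mult_nth scale_sum_left atMost_atLeast0)
      finally show "fps_nth (fps_scale s a (fps_scale s b x)) n = fps_nth (fps_scale s (a * b) x) n" .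
    qed
  qed
qed

text \<open>The \<open>K[[t]]\<close>-multilinear extension to \<open>L[[t]]\<close> of a formal sum \<open>\<Sum>\<^sub>i F\<^sub>i t\<^sup>i\<close> of multilinear
  maps on \<open>L\<close>: the coefficient of \<open>t\<^sup>n\<close> collects all products of total degree \<open>n\<close>.\<close>

definition fps_ext1 ::
  "(nat \<Rightarrow> 'l \<Rightarrow> 'l) \<Rightarrow> 'l::ab_group_add fps \<Rightarrow> 'l fps" where
  "fps_ext1 P x = Abs_fps (\<lambda>n. \<Sum>(i, p) \<in> {(i, p). i + p = n}. P i (fps_nth x p))"

definition fps_ext2 ::
  "(nat \<Rightarrow> 'l \<Rightarrow> 'l \<Rightarrow> 'l) \<Rightarrow> 'l::ab_group_add fps \<Rightarrow> 'l fps \<Rightarrow> 'l fps" where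
  "fps_ext2 F x y = Abs_fps (\<lambda>n. \<Sum>(i, p, q) \<in> {(i, p, q). i + p + q = n}.
      F i (fps_nth x p) (fps_nth y q))"

definition fps_ext3 ::
  "(nat \<Rightarrow> 'l \<Rightarrow> 'l \<Rightarrow> 'l \<Rightarrow> 'l) \<Rightarrow>
     'l::ab_group_add fps \<Rightarrow> 'l fps \<Rightarrow> 'l fps \<Rightarrow> 'l fps" where
  "fps_ext3 H x y z = Abs_fps (\<lambda>n. \<Sum>(i, p, q, r) \<in> {(i, p, q, r). i + p + q + r = n}.
      H i (fps_nth x p) (fps_nth y q) (fps_nth z r))"

section \<open>Lie-Yamaguti algebras with an action of a finite group\<close>

locale equivariant_lie_yamaguti =
  lie_yamaguti scale br tr + group G
  for scale :: "'k::field \<Rightarrow> 'l::ab_group_add \<Rightarrow> 'l"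
    and br :: "'l \<Rightarrow> 'l \<Rightarrow> 'l"
    and tr :: "'l \<Rightarrow> 'l \<Rightarrow> 'l \<Rightarrow> 'l"
    and G :: "('g, 'm) monoid_scheme" (structure) +
  fixes act :: "'g \<Rightarrow> 'l \<Rightarrow> 'l"
  assumes finite_group: "finite (carrier G)"
    and act_linear: "\<sigma> \<in> carrier G \<Longrightarrow> module_hom scale scale (act \<sigma>)"
    and act_one: "act \<one> a = a"
    and act_mult: "\<sigma> \<in> carrier G \<Longrightarrow> \<tau> \<in> carrier G \<Longrightarrow> act \<sigma> (act \<tau> a) = act (\<sigma> \<otimes> \<tau>) a"
    and act_br: "\<sigma> \<in> carrier G \<Longrightarrow> act \<sigma> (br a b) = br (act \<sigma> a) (act \<sigma> b)"
    and act_tr: "\<sigma> \<in> carrier G \<Longrightarrow> act \<sigma> (tr a b c) = tr (act \<sigma> a) (act \<sigma> b) (act \<sigma> c)"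
begin

definition equivariant1 :: "('l \<Rightarrow> 'l) \<Rightarrow> bool" where
  "equivariant1 h \<longleftrightarrow> (\<forall>\<sigma>\<in>carrier G. \<forall>x. h (act \<sigma> x) = act \<sigma> (h x))"

definition equivariant2 :: "('l \<Rightarrow> 'l \<Rightarrow> 'l) \<Rightarrow> bool" where
  "equivariant2 f \<longleftrightarrow> (\<forall>\<sigma>\<in>carrier G. \<forall>x y. f (act \<sigma> x) (act \<sigma> y) = act \<sigma> (f x y))"

definition equivariant3 :: "('l \<Rightarrow> 'l \<Rightarrow> 'l \<Rightarrow> 'l) \<Rightarrow> bool" where
  "equivariant3 g \<longleftrightarrow>
     (\<forall>\<sigma>\<in>carrier G. \<forall>x y z. g (act \<sigma> x) (act \<sigma> y) (act \<sigma> z) = act \<sigma> (g x y z))"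

subsection \<open>Equivariant formal deformations and rigidity\<close>

definition equivariant_deformation ::
  "(nat \<Rightarrow> 'l \<Rightarrow> 'l \<Rightarrow> 'l) \<Rightarrow> (nat \<Rightarrow> 'l \<Rightarrow> 'l \<Rightarrow> 'l \<Rightarrow> 'l) \<Rightarrow> bool" where
  "equivariant_deformation f g \<longleftrightarrow>
     f 0 = br \<and> g 0 = tr \<and>
     (\<forall>i. bilinear_op scale (f i)) \<and> (\<forall>i. trilinear_op scale (g i)) \<and>
     lie_yamaguti (fps_scale scale) (fps_ext2 f) (fps_ext3 g) \<and>
     (\<forall>i\<ge>1. equivariant2 (f i) \<and> equivariant3 (g i))"

definition null_br :: "nat \<Rightarrow> 'l \<Rightarrow> 'l \<Rightarrow> 'l" where
  "null_br i = (if i = 0 then br else 0)"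

definition null_tr :: "nat \<Rightarrow> 'l \<Rightarrow> 'l \<Rightarrow> 'l \<Rightarrow> 'l" where
  "null_tr i = (if i = 0 then tr else 0)"

definition equivalent_deformations ::
  "(nat \<Rightarrow> 'l \<Rightarrow> 'l \<Rightarrow> 'l) \<Rightarrow> (nat \<Rightarrow> 'l \<Rightarrow> 'l \<Rightarrow> 'l \<Rightarrow> 'l) \<Rightarrow>
     (nat \<Rightarrow> 'l \<Rightarrow> 'l \<Rightarrow> 'l) \<Rightarrow> (nat \<Rightarrow> 'l \<Rightarrow> 'l \<Rightarrow> 'l \<Rightarrow> 'l) \<Rightarrow> bool" where
  "equivalent_deformations f g f' g' \<longleftrightarrow>
     (\<exists>\<phi> :: nat \<Rightarrow> 'l \<Rightarrow> 'l.
        (\<forall>i. module_hom scale scale (\<phi> i)) \<and> \<phi> 0 = id \<and> (\<forall>i. equivariant1 (\<phi> i)) \<and>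
        module_hom (fps_scale scale) (fps_scale scale) (fps_ext1 \<phi>) \<and> bij (fps_ext1 \<phi>) \<and>
        (\<forall>x y. fps_ext1 \<phi> (fps_ext2 f x y) = fps_ext2 f' (fps_ext1 \<phi> x) (fps_ext1 \<phi> y)) \<and>
        (\<forall>x y z. fps_ext1 \<phi> (fps_ext3 g x y z) =
                   fps_ext3 g' (fps_ext1 \<phi> x) (fps_ext1 \<phi> y) (fps_ext1 \<phi> z)))"

definition trivial_deformation ::
  "(nat \<Rightarrow> 'l \<Rightarrow> 'l \<Rightarrow> 'l) \<Rightarrow> (nat \<Rightarrow> 'l \<Rightarrow> 'l \<Rightarrow> 'l \<Rightarrow> 'l) \<Rightarrow> bool" where
  "trivial_deformation f g \<longleftrightarrow> equivalent_deformations f g null_br null_tr"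

definition equivariantly_rigid :: bool where
  "equivariantly_rigid \<longleftrightarrow>
     (\<forall>f g. equivariant_deformation f g \<longrightarrow> trivial_deformation f g)"

subsection \<open>Equivariant cohomology with adjoint coefficients\<close>

text \<open>The cochain spaces \<open>C\<^sup>n\<^sub>G(L, L)\<close> for \<open>n = 1, 2, 3\<close>, in curried form. The vanishing condition
  on \<open>x\<^bsub>2i-1\<^esub> = x\<^bsub>2i\<^esub>\<close>, \<open>2i \<le> n\<close>, is void for \<open>n = 1\<close> and concerns only the first two arguments
  for \<open>n = 2, 3\<close>.\<close>

definition C1 :: "('l \<Rightarrow> 'l) set" where
  "C1 = {h. module_hom scale scale h \<and> equivariant1 h}"

definition C2 :: "('l \<Rightarrow> 'l \<Rightarrow> 'l) set" where
  "C2 = {f. bilinear_op scale f \<and> (\<forall>x. f x x = 0) \<and> equivariant2 f}"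

definition C3 :: "('l \<Rightarrow> 'l \<Rightarrow> 'l \<Rightarrow> 'l) set" where
  "C3 = {g. trilinear_op scale g \<and> (\<forall>x z. g x x z = 0) \<and> equivariant3 g}"

definition delta1_I :: "('l \<Rightarrow> 'l) \<Rightarrow> 'l \<Rightarrow> 'l \<Rightarrow> 'l" where
  "delta1_I h x y = br x (h y) - br y (h x) - h (br x y)"

definition delta1_II :: "('l \<Rightarrow> 'l) \<Rightarrow> 'l \<Rightarrow> 'l \<Rightarrow> 'l \<Rightarrow> 'l" where
  "delta1_II h x y z = tr (h x) y z - tr (h y) x z + tr x y (h z) - h (tr x y z)"

definition delta_I ::
  "('l \<Rightarrow> 'l \<Rightarrow> 'l) \<Rightarrow> ('l \<Rightarrow> 'l \<Rightarrow> 'l \<Rightarrow> 'l) \<Rightarrow> 'l \<Rightarrow> 'l \<Rightarrow> 'l \<Rightarrow> 'l \<Rightarrow> 'l" where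
  "delta_I f g x1 x2 x3 x4 =
     br x3 (g x1 x2 x4) - br x4 (g x1 x2 x3) - g x1 x2 (br x3 x4)
     - tr x1 x2 (f x3 x4) + f (tr x1 x2 x3) x4 + f x3 (tr x1 x2 x4)"

definition delta_II ::
  "('l \<Rightarrow> 'l \<Rightarrow> 'l \<Rightarrow> 'l) \<Rightarrow> 'l \<Rightarrow> 'l \<Rightarrow> 'l \<Rightarrow> 'l \<Rightarrow> 'l \<Rightarrow> 'l" where
  "delta_II g x1 x2 x3 x4 x5 =
     tr (g x1 x2 x3) x4 x5 - tr (g x1 x2 x4) x3 x5
     - tr x1 x2 (g x3 x4 x5) + tr x3 x4 (g x1 x2 x5)
     + g (tr x1 x2 x3) x4 x5 + g x3 (tr x1 x2 x4) x5
     + g x3 x4 (tr x1 x2 x5) - g x1 x2 (tr x3 x4 x5)"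

text \<open>\<open>Z23\<close>, \<open>B23\<close> and \<open>H23\<close> are the spaces written \<open>Z\<^sup>2\<^sub>G \<times> Z\<^sup>3\<^sub>G\<close>, \<open>B\<^sup>2\<^sub>G \<times> B\<^sup>3\<^sub>G\<close> and
  \<open>H\<^sup>2\<^sub>G \<times> H\<^sup>3\<^sub>G\<close>; the product signs there are notation, the conditions couple the two components.\<close>

definition Z23 :: "(('l \<Rightarrow> 'l \<Rightarrow> 'l) \<times> ('l \<Rightarrow> 'l \<Rightarrow> 'l \<Rightarrow> 'l)) set" where
  "Z23 = {(f, g). f \<in> C2 \<and> g \<in> C3 \<and> delta_I f g = 0 \<and> delta_II g = 0}"

definition B23 :: "(('l \<Rightarrow> 'l \<Rightarrow> 'l) \<times> ('l \<Rightarrow> 'l \<Rightarrow> 'l \<Rightarrow> 'l)) set" where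
  "B23 = {(delta1_I h, delta1_II h) | h. h \<in> C1}"

definition cohomologous ::
  "((('l \<Rightarrow> 'l \<Rightarrow> 'l) \<times> ('l \<Rightarrow> 'l \<Rightarrow> 'l \<Rightarrow> 'l)) \<times> (('l \<Rightarrow> 'l \<Rightarrow> 'l) \<times> ('l \<Rightarrow> 'l \<Rightarrow> 'l \<Rightarrow> 'l))) set"
  where "cohomologous = {(p, q). p \<in> Z23 \<and> q \<in> Z23 \<and> p - q \<in> B23}"

definition H23 :: "(('l \<Rightarrow> 'l \<Rightarrow> 'l) \<times> ('l \<Rightarrow> 'l \<Rightarrow> 'l \<Rightarrow> 'l)) set set" where
  "H23 = Z23 // cohomologous"

definition H23_zero :: "(('l \<Rightarrow> 'l \<Rightarrow> 'l) \<times> ('l \<Rightarrow> 'l \<Rightarrow> 'l \<Rightarrow> 'l)) set" where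
  "H23_zero = cohomologous `` {0}"

end

end

theory Submission
  imports Defs
begin

text \<open>An equivalence \<open>\<phi>\<close> with the null deformation is built one coefficient at a time. Suppose
  \<open>\<phi>\<^sub>0 = id, \<dots>, \<phi>\<^bsub>n-1\<^esub>\<close> make \<open>\<phi> f(x, y) - [\<phi> x, \<phi> y]\<close> and \<open>\<phi> g(x, y, z) - {\<phi> x, \<phi> y, \<phi> z}\<close> vanish
  below order \<open>n\<close>. Axioms (LY5) and (LY6) show that the coefficients of \<open>t\<^sup>n\<close> of these two defects form
  a cocycle, hence equal \<open>(\<delta>\<^sub>I h, \<delta>\<^bsub>II\<^esub> h)\<close> for some equivariant \<open>h\<close>; choosing \<open>\<phi>\<^sub>n = h\<close> kills them, because
  this changes them by exactly \<open>-(\<delta>\<^sub>I h, \<delta>\<^bsub>II\<^esub> h)\<close>. No inverse of \<open>\<phi>\<close> is needed along the way.\<close>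

section \<open>Linear maps of formal power series\<close>

text \<open>Multiplication by \<open>t\<close>, encoded as a shift of coefficients: the coefficients
  lie in a module, where no product with a power series variable is available.\<close>

definition fps_delay :: "'a::zero fps \<Rightarrow> 'a fps" where
  "fps_delay x = Abs_fps (\<lambda>n. case n of 0 \<Rightarrow> 0 | Suc m \<Rightarrow> fps_nth x m)"

lemma fps_delay_nth_0 [simp]: "fps_nth (fps_delay x) 0 = 0"
  and fps_delay_nth_Suc [simp]: "fps_nth (fps_delay x) (Suc n) = fps_nth x n"
  by (simp_all add: fps_delay_def)

lemma fps_delay_add: "fps_delay (x + y) = fps_delay x + fps_delay (y :: 'a::monoid_add fps)"
  by (rule fps_ext) (simp add: fps_delay_def split: nat.split)

lemma fps_delay_uminus: "fps_delay (- x) = - fps_delay (x :: 'a::group_add fps)"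
  by (rule fps_ext) (simp add: fps_delay_def split: nat.split)

lemma fps_delay_funpow_nth:
  "fps_nth ((fps_delay ^^ n) x) k = (if k < n then 0 else fps_nth x (k - n))"
proof (induction n arbitrary: k)
  case (Suc n)
  then show ?case by (cases k) auto
qed simp

lemma fps_const_uminus: "fps_const (- a) = - fps_const (a :: 'a::group_add)"
  by (rule fps_ext) simp

lemma fps_eq_const_plus_delay:
  "x = fps_const (fps_nth x 0) + fps_delay (fps_shift 1 (x :: 'a::monoid_add fps))"
proof (rule fps_ext)
  fix n show "fps_nth x n = fps_nth (fps_const (fps_nth x 0) + fps_delay (fps_shift 1 x)) n"
    by (cases n) auto
qed

text \<open>Additive maps commuting with multiplication by \<open>t\<close>: unlike \<open>K[[t]]\<close>-linearity this does not
  mention scalars, and it already determines a map by its values on constant series.\<close>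

definition delay_linear :: "('a::ab_group_add fps \<Rightarrow> 'b::ab_group_add fps) \<Rightarrow> bool" where
  "delay_linear A \<longleftrightarrow>
     (\<forall>x y. A (x + y) = A x + A y) \<and> (\<forall>x. A (fps_delay x) = fps_delay (A x))"

lemma delay_linear_add: "delay_linear A \<Longrightarrow> A (x + y) = A x + A y"
  and delay_linear_delay: "delay_linear A \<Longrightarrow> A (fps_delay x) = fps_delay (A x)"
  by (simp_all add: delay_linear_def)

lemma delay_linear_0: "delay_linear A \<Longrightarrow> A 0 = 0"
  using delay_linear_add[of A 0 0] by simp

lemma delay_linear_uminus: "delay_linear A \<Longrightarrow> A (- x) = - A x"
  using delay_linear_add[of A "- x" x] by (simp add: delay_linear_0 eq_neg_iff_add_eq_0)

lemma delay_linear_diff: "delay_linear A \<Longrightarrow> A (x - y) = A x - A y"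
  using delay_linear_add[of A x "- y"] by (simp add: delay_linear_uminus)

lemma delay_linear_funpow:
  "delay_linear A \<Longrightarrow> A ((fps_delay ^^ n) x) = (fps_delay ^^ n) (A x)"
  by (induction n) (auto simp: delay_linear_delay)

lemma delay_linearI:
  assumes add: "\<And>x y. A (x + y) = A x + A y"
    and delay_0: "\<And>x. fps_nth (A (fps_delay x)) 0 = 0"
    and delay_Suc: "\<And>x n. fps_nth (A (fps_delay x)) (Suc n) = fps_nth (A x) n"
  shows "delay_linear A"
  unfolding delay_linear_def
proof (intro conjI allI)
  fix x y show "A (x + y) = A x + A y" by (rule add)
next
  fix x show "A (fps_delay x) = fps_delay (A x)"
  proof (rule fps_ext)
    fix n show "fps_nth (A (fps_delay x)) n = fps_nth (fps_delay (A x)) n"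
      by (cases n) (simp_all add: delay_0 delay_Suc)
  qed
qed

named_theorems delay_linear_intros

lemma delay_linear_id [delay_linear_intros]: "delay_linear (\<lambda>x. x)"
  by (simp add: delay_linear_def)

lemma delay_linear_zero [delay_linear_intros]: "delay_linear (\<lambda>x. 0)"
  by (rule delay_linearI) simp_all

lemma delay_linear_plus [delay_linear_intros]:
  "delay_linear A \<Longrightarrow> delay_linear B \<Longrightarrow> delay_linear (\<lambda>x. A x + B x)"
  by (simp add: delay_linear_def fps_delay_add algebra_simps)

lemma delay_linear_neg [delay_linear_intros]:
  "delay_linear A \<Longrightarrow> delay_linear (\<lambda>x. - A x)"
  by (simp add: delay_linear_def fps_delay_uminus)

lemma delay_linear_minus [delay_linear_intros]:
  "delay_linear A \<Longrightarrow> delay_linear B \<Longrightarrow> delay_linear (\<lambda>x. A x - B x)"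
  using delay_linear_plus[of A "\<lambda>x. - B x"] delay_linear_neg[of B] by simp

lemma delay_linear_compose:
  "delay_linear A \<Longrightarrow> delay_linear B \<Longrightarrow> delay_linear (\<lambda>x. A (B x))"
  by (simp add: delay_linear_def)

text \<open>Induction on \<open>k\<close> for all \<open>x\<close> at once. In the decomposition x =
  x_0 + t x' the constant part is covered by \<open>const\<close>, and coefficient \<open>k\<close>
  of A (t x') is coefficient k - 1 of A x'. Any given coefficient is reached after finitely many
  such steps, which stands in for t-adic continuity.\<close>

lemma delay_linear_vanish:
  assumes A: "delay_linear A"
    and const: "\<And>a k. k < n \<Longrightarrow> fps_nth (A (fps_const a)) k = 0"
  shows "k < n \<Longrightarrow> fps_nth (A x) k = 0"
proof (induction k arbitrary: x)
  case 0
  then show ?case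
    using arg_cong[OF fps_eq_const_plus_delay[of x], of A]
    by (simp add: delay_linear_add[OF A] delay_linear_delay[OF A] const)
next
  case (Suc k)
  then show ?case
    using arg_cong[OF fps_eq_const_plus_delay[of x], of A]
    by (simp add: delay_linear_add[OF A] delay_linear_delay[OF A] const)
qed

text \<open>\<open>delay_linear_vanish\<close> for the difference of the two maps, at every order.
  This is how identities on L[[t]] are reduced to L, one argument at a time.\<close>

lemma delay_linear_eqI:
  assumes A: "delay_linear A" and B: "delay_linear B"
    and const: "\<And>a. A (fps_const a) = B (fps_const a)"
  shows "A x = B x"
proof (rule fps_ext)
  fix k
  have "fps_nth (A x - B x) k = 0"
    by (rule delay_linear_vanish[where n = "Suc k" and A = "\<lambda>x. A x - B x"])
       (auto intro: delay_linear_minus A B simp: const)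
  then show "fps_nth (A x) k = fps_nth (B x) k" by simp
qed

text \<open>With x = x_0 + t x', coefficient \<open>n\<close> of A (t x') is coefficient n - 1 of A
  x', which is already 0. So the leading coefficient of \<open>A\<close> sees only x_0.\<close>

lemma delay_linear_nth_vanishing:
  assumes A: "delay_linear A"
    and const: "\<And>a k. k < n \<Longrightarrow> fps_nth (A (fps_const a)) k = 0"
  shows "fps_nth (A x) n = fps_nth (A (fps_const (fps_nth x 0))) n"
proof (cases n)
  case 0
  then show ?thesis
    using arg_cong[OF fps_eq_const_plus_delay[of x], of A]
    by (simp add: delay_linear_add[OF A] delay_linear_delay[OF A])
next
  case (Suc m)
  have "fps_nth (A (fps_shift 1 x)) m = 0"
    using delay_linear_vanish[OF A, where n = n] const Suc by blast
  then show ?thesis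
    using arg_cong[OF fps_eq_const_plus_delay[of x], of A] Suc
    by (simp add: delay_linear_add[OF A] delay_linear_delay[OF A])
qed

lemma delay_linear_nth_0:
  "delay_linear A \<Longrightarrow> fps_nth (A x) 0 = fps_nth (A (fps_const (fps_nth x 0))) 0"
  by (rule delay_linear_nth_vanishing) auto

text \<open>Here \<open>x\<close> is t^n times its shift by \<open>n\<close>, and t^n passes through
  \<open>A\<close>. Coefficient \<open>n\<close> thus becomes the constant coefficient of
  \<open>A\<close> at the shift, whose own constant coefficient is that of t^n in
  \<open>x\<close>.\<close>

lemma delay_linear_nth_high_order:
  assumes A: "delay_linear A" and low: "\<And>k. k < n \<Longrightarrow> fps_nth x k = 0"
  shows "fps_nth (A x) n = fps_nth (A (fps_const (fps_nth x n))) 0"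
proof -
  have x: "x = (fps_delay ^^ n) (fps_shift n x)"
    by (rule fps_ext) (auto simp: fps_delay_funpow_nth low)
  have "fps_nth (A x) n = fps_nth (A (fps_shift n x)) 0"
    by (subst x) (simp add: delay_linear_funpow[OF A] fps_delay_funpow_nth)
  also have "\<dots> = fps_nth (A (fps_const (fps_nth x n))) 0"
    by (subst delay_linear_nth_0[OF A]) simp
  finally show ?thesis .
qed

lemma delay_linear_nth_perturb:
  assumes A: "delay_linear A" and low: "\<And>k. k < n \<Longrightarrow> fps_nth y k = fps_nth x k"
  shows "fps_nth (A y) n =
    fps_nth (A x) n + fps_nth (A (fps_const (fps_nth y n - fps_nth x n))) 0"
proof -
  have "fps_nth (A (y - x)) n = fps_nth (A (fps_const (fps_nth (y - x) n))) 0"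
    by (rule delay_linear_nth_high_order[OF A]) (simp add: low)
  then show ?thesis by (simp add: delay_linear_diff[OF A] algebra_simps)
qed

section \<open>Multilinear extensions of formal sums commute with t in each argument\<close>

lemma finite_splits2: "finite {(i, p). i + p = (n::nat)}"
  by (rule finite_subset[of _ "{..n} \<times> {..n}"]) auto

lemma finite_splits3: "finite {(i, p, q). i + p + q = (n::nat)}"
  by (rule finite_subset[of _ "{..n} \<times> {..n} \<times> {..n}"]) auto

lemma finite_splits4: "finite {(i, p, q, r). i + p + q + r = (n::nat)}"
  by (rule finite_subset[of _ "{..n} \<times> {..n} \<times> {..n} \<times> {..n}"]) auto

lemmas finite_splits = finite_splits2 finite_splits3 finite_splits4

lemma fps_ext1_nth: "fps_nth (fps_ext1 P x) n = (\<Sum>(i, p) \<in> {(i, p). i + p = n}. P i (fps_nth x p))"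
  by (simp add: fps_ext1_def)

lemma fps_ext2_nth: "fps_nth (fps_ext2 F x y) n =
    (\<Sum>(i, p, q) \<in> {(i, p, q). i + p + q = n}. F i (fps_nth x p) (fps_nth y q))"
  by (simp add: fps_ext2_def)

lemma fps_ext3_nth: "fps_nth (fps_ext3 H x y z) n =
    (\<Sum>(i, p, q, r) \<in> {(i, p, q, r). i + p + q + r = n}.
      H i (fps_nth x p) (fps_nth y q) (fps_nth z r))"
  by (simp add: fps_ext3_def)

lemma fps_ext1_nth_cong:
  "(\<And>i. i \<le> n \<Longrightarrow> P i = P' i) \<Longrightarrow> (\<And>i. i \<le> n \<Longrightarrow> fps_nth x i = fps_nth x' i) \<Longrightarrow>
    fps_nth (fps_ext1 P x) n = fps_nth (fps_ext1 P' x') n"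
  unfolding fps_ext1_nth by (rule sum.cong) auto

lemma fps_ext2_nth_cong:
  "(\<And>i. i \<le> n \<Longrightarrow> fps_nth x i = fps_nth x' i) \<Longrightarrow>
   (\<And>i. i \<le> n \<Longrightarrow> fps_nth y i = fps_nth y' i) \<Longrightarrow>
    fps_nth (fps_ext2 F x y) n = fps_nth (fps_ext2 F x' y') n"
  unfolding fps_ext2_nth by (rule sum.cong) auto

lemma fps_ext3_nth_cong:
  "(\<And>i. i \<le> n \<Longrightarrow> fps_nth x i = fps_nth x' i) \<Longrightarrow>
   (\<And>i. i \<le> n \<Longrightarrow> fps_nth y i = fps_nth y' i) \<Longrightarrow>
   (\<And>i. i \<le> n \<Longrightarrow> fps_nth z i = fps_nth z' i) \<Longrightarrow>
    fps_nth (fps_ext3 F x y z) n = fps_nth (fps_ext3 F x' y' z') n"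
  unfolding fps_ext3_nth by (rule sum.cong) auto

context module
begin

lemma bilinear_op_zero_left: "bilinear_op scale F \<Longrightarrow> F 0 b = 0"
  and bilinear_op_zero_right: "bilinear_op scale F \<Longrightarrow> F a 0 = 0"
  and bilinear_op_add_left: "bilinear_op scale F \<Longrightarrow> F (a + a') b = F a b + F a' b"
  and bilinear_op_add_right: "bilinear_op scale F \<Longrightarrow> F a (b + b') = F a b + F a b'"
  and bilinear_op_scale_left: "bilinear_op scale F \<Longrightarrow> F (scale k a) b = scale k (F a b)"
  and bilinear_op_scale_right: "bilinear_op scale F \<Longrightarrow> F a (scale k b) = scale k (F a b)"
  unfolding bilinear_op_def
  by (meson module_hom.zero module_hom.add module_hom.scale)+

lemma trilinear_op_zero1: "trilinear_op scale H \<Longrightarrow> H 0 b c = 0"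
  and trilinear_op_zero2: "trilinear_op scale H \<Longrightarrow> H a 0 c = 0"
  and trilinear_op_zero3: "trilinear_op scale H \<Longrightarrow> H a b 0 = 0"
  and trilinear_op_add1: "trilinear_op scale H \<Longrightarrow> H (a + a') b c = H a b c + H a' b c"
  and trilinear_op_add2: "trilinear_op scale H \<Longrightarrow> H a (b + b') c = H a b c + H a b' c"
  and trilinear_op_add3: "trilinear_op scale H \<Longrightarrow> H a b (c + c') = H a b c + H a b c'"
  and trilinear_op_scale1: "trilinear_op scale H \<Longrightarrow> H (scale k a) b c = scale k (H a b c)"
  and trilinear_op_scale2: "trilinear_op scale H \<Longrightarrow> H a (scale k b) c = scale k (H a b c)"
  and trilinear_op_scale3: "trilinear_op scale H \<Longrightarrow> H a b (scale k c) = scale k (H a b c)"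
  unfolding trilinear_op_def
  by (meson module_hom.zero module_hom.add module_hom.scale)+

lemmas bilinear_op_simps =
  bilinear_op_zero_left bilinear_op_zero_right bilinear_op_add_left bilinear_op_add_right
  bilinear_op_scale_left bilinear_op_scale_right

lemmas trilinear_op_simps =
  trilinear_op_zero1 trilinear_op_zero2 trilinear_op_zero3
  trilinear_op_add1 trilinear_op_add2 trilinear_op_add3
  trilinear_op_scale1 trilinear_op_scale2 trilinear_op_scale3

lemma bilinear_op_iff:
  "bilinear_op scale F \<longleftrightarrow>
     (\<forall>a a' b. F (a + a') b = F a b + F a' b) \<and> (\<forall>k a b. F (scale k a) b = scale k (F a b)) \<and>
     (\<forall>a b b'. F a (b + b') = F a b + F a b') \<and> (\<forall>k a b. F a (scale k b) = scale k (F a b))"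
  by (auto simp: bilinear_op_def module_hom_iff module_axioms)

lemma trilinear_op_iff:
  "trilinear_op scale H \<longleftrightarrow>
     (\<forall>a a' b c. H (a + a') b c = H a b c + H a' b c) \<and>
     (\<forall>k a b c. H (scale k a) b c = scale k (H a b c)) \<and>
     (\<forall>a b b' c. H a (b + b') c = H a b c + H a b' c) \<and>
     (\<forall>k a b c. H a (scale k b) c = scale k (H a b c)) \<and>
     (\<forall>a b c c'. H a b (c + c') = H a b c + H a b c') \<and>
     (\<forall>k a b c. H a b (scale k c) = scale k (H a b c))"
  by (auto simp: trilinear_op_def module_hom_iff module_axioms)

lemma delay_linear_ext1_arg:
  assumes P: "\<And>i. module_hom scale scale (P i)"
  shows "delay_linear (fps_ext1 P)"
proof (rule delay_linearI)
  note P = module_hom.zero[OF P] module_hom.add[OF P]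
  show "fps_ext1 P (x + y) = fps_ext1 P x + fps_ext1 P y" for x y
    by (rule fps_ext)
       (simp add: fps_ext1_nth P sum.distrib[symmetric] case_prod_unfold)
  show "fps_nth (fps_ext1 P (fps_delay x)) 0 = 0" for x
    unfolding fps_ext1_nth by (rule sum.neutral) (auto simp: P)
  \<comment> \<open>Splittings of n + 1 with p = 0 meet the vanishing constant coefficient of
    \<open>fps_delay x\<close>; they form the discarded set \<open>T'\<close>. The others correspond
    to the splittings of \<open>n\<close> by raising \<open>p\<close> by one. The same reindexing
    serves every argument of the bilinear and trilinear extensions below.\<close>
  show "fps_nth (fps_ext1 P (fps_delay x)) (Suc n) = fps_nth (fps_ext1 P x) n" for x n
    unfolding fps_ext1_nth
    by (rule sum.reindex_bij_witness_not_neutral[symmetric, where S' = "{}"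
          and T' = "{(i, p). i + p = Suc n \<and> p = 0}"
          and j = "\<lambda>(i, p). (i, Suc p)" and i = "\<lambda>(i, p). (i, p - 1)"])
       (auto simp: P gr0_conv_Suc fps_delay_def split: nat.splits
             intro: finite_subset[OF _ finite_splits2[of "Suc n"]])
qed

lemma delay_linear_ext2_arg1:
  assumes F: "\<And>i. bilinear_op scale (F i)"
  shows "delay_linear (\<lambda>x. fps_ext2 F x y)"
proof (rule delay_linearI)
  note F = bilinear_op_simps[OF F]
  show "fps_ext2 F (x + x') y = fps_ext2 F x y + fps_ext2 F x' y" for x x'
    by (rule fps_ext)
       (simp add: fps_ext2_nth F sum.distrib[symmetric] case_prod_unfold)
  show "fps_nth (fps_ext2 F (fps_delay x) y) 0 = 0" for x
    unfolding fps_ext2_nth by (rule sum.neutral) (auto simp: F)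
  show "fps_nth (fps_ext2 F (fps_delay x) y) (Suc n) = fps_nth (fps_ext2 F x y) n" for x n
    unfolding fps_ext2_nth
    by (rule sum.reindex_bij_witness_not_neutral[symmetric, where S' = "{}"
          and T' = "{(i, p, q). i + p + q = Suc n \<and> p = 0}"
          and j = "\<lambda>(i, p, q). (i, Suc p, q)" and i = "\<lambda>(i, p, q). (i, p - 1, q)"])
       (auto simp: F fps_delay_def split: nat.splits
             intro: finite_subset[OF _ finite_splits3[of "Suc n"]])
qed

lemma delay_linear_ext2_arg2:
  assumes F: "\<And>i. bilinear_op scale (F i)"
  shows "delay_linear (fps_ext2 F x)"
proof (rule delay_linearI)
  note F = bilinear_op_simps[OF F]
  show "fps_ext2 F x (y + y') = fps_ext2 F x y + fps_ext2 F x y'" for y y'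
    by (rule fps_ext)
       (simp add: fps_ext2_nth F sum.distrib[symmetric] case_prod_unfold)
  show "fps_nth (fps_ext2 F x (fps_delay y)) 0 = 0" for y
    unfolding fps_ext2_nth by (rule sum.neutral) (auto simp: F)
  show "fps_nth (fps_ext2 F x (fps_delay y)) (Suc n) = fps_nth (fps_ext2 F x y) n" for y n
    unfolding fps_ext2_nth
    by (rule sum.reindex_bij_witness_not_neutral[symmetric, where S' = "{}"
          and T' = "{(i, p, q). i + p + q = Suc n \<and> q = 0}"
          and j = "\<lambda>(i, p, q). (i, p, Suc q)" and i = "\<lambda>(i, p, q). (i, p, q - 1)"])
       (auto simp: F fps_delay_def split: nat.splits
             intro: finite_subset[OF _ finite_splits3[of "Suc n"]])
qed

lemma delay_linear_ext3_arg1: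
  assumes H: "\<And>i. trilinear_op scale (H i)"
  shows "delay_linear (\<lambda>x. fps_ext3 H x y z)"
proof (rule delay_linearI)
  note H = trilinear_op_simps[OF H]
  show "fps_ext3 H (x + x') y z = fps_ext3 H x y z + fps_ext3 H x' y z" for x x'
    by (rule fps_ext)
       (simp add: fps_ext3_nth H sum.distrib[symmetric] case_prod_unfold)
  show "fps_nth (fps_ext3 H (fps_delay x) y z) 0 = 0" for x
    unfolding fps_ext3_nth by (rule sum.neutral) (auto simp: H)
  show "fps_nth (fps_ext3 H (fps_delay x) y z) (Suc n) = fps_nth (fps_ext3 H x y z) n" for x n
    unfolding fps_ext3_nth
    by (rule sum.reindex_bij_witness_not_neutral[symmetric, where S' = "{}"
          and T' = "{(i, p, q, r). i + p + q + r = Suc n \<and> p = 0}"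
          and j = "\<lambda>(i, p, q, r). (i, Suc p, q, r)" and i = "\<lambda>(i, p, q, r). (i, p - 1, q, r)"])
       (auto simp: H fps_delay_def split: nat.splits
             intro: finite_subset[OF _ finite_splits4[of "Suc n"]])
qed

lemma delay_linear_ext3_arg2:
  assumes H: "\<And>i. trilinear_op scale (H i)"
  shows "delay_linear (\<lambda>y. fps_ext3 H x y z)"
proof (rule delay_linearI)
  note H = trilinear_op_simps[OF H]
  show "fps_ext3 H x (y + y') z = fps_ext3 H x y z + fps_ext3 H x y' z" for y y'
    by (rule fps_ext)
       (simp add: fps_ext3_nth H sum.distrib[symmetric] case_prod_unfold)
  show "fps_nth (fps_ext3 H x (fps_delay y) z) 0 = 0" for y
    unfolding fps_ext3_nth by (rule sum.neutral) (auto simp: H)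
  show "fps_nth (fps_ext3 H x (fps_delay y) z) (Suc n) = fps_nth (fps_ext3 H x y z) n" for y n
    unfolding fps_ext3_nth
    by (rule sum.reindex_bij_witness_not_neutral[symmetric, where S' = "{}"
          and T' = "{(i, p, q, r). i + p + q + r = Suc n \<and> q = 0}"
          and j = "\<lambda>(i, p, q, r). (i, p, Suc q, r)" and i = "\<lambda>(i, p, q, r). (i, p, q - 1, r)"])
       (auto simp: H fps_delay_def split: nat.splits
             intro: finite_subset[OF _ finite_splits4[of "Suc n"]])
qed

lemma delay_linear_ext3_arg3:
  assumes H: "\<And>i. trilinear_op scale (H i)"
  shows "delay_linear (fps_ext3 H x y)"
proof (rule delay_linearI)
  note H = trilinear_op_simps[OF H]
  show "fps_ext3 H x y (z + z') = fps_ext3 H x y z + fps_ext3 H x y z'" for z z'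
    by (rule fps_ext)
       (simp add: fps_ext3_nth H sum.distrib[symmetric] case_prod_unfold)
  show "fps_nth (fps_ext3 H x y (fps_delay z)) 0 = 0" for z
    unfolding fps_ext3_nth by (rule sum.neutral) (auto simp: H)
  show "fps_nth (fps_ext3 H x y (fps_delay z)) (Suc n) = fps_nth (fps_ext3 H x y z) n" for z n
    unfolding fps_ext3_nth
    by (rule sum.reindex_bij_witness_not_neutral[symmetric, where S' = "{}"
          and T' = "{(i, p, q, r). i + p + q + r = Suc n \<and> r = 0}"
          and j = "\<lambda>(i, p, q, r). (i, p, q, Suc r)" and i = "\<lambda>(i, p, q, r). (i, p, q, r - 1)"])
       (auto simp: H fps_delay_def split: nat.splits
             intro: finite_subset[OF _ finite_splits4[of "Suc n"]])
qed

lemma delay_linear_ext1: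
  "(\<And>i. module_hom scale scale (P i)) \<Longrightarrow> delay_linear A \<Longrightarrow> delay_linear (\<lambda>x. fps_ext1 P (A x))"
  by (rule delay_linear_compose[OF delay_linear_ext1_arg])

lemma delay_linear_ext2:
  "(\<And>i. bilinear_op scale (F i)) \<Longrightarrow> delay_linear A \<Longrightarrow> delay_linear (\<lambda>x. fps_ext2 F (A x) y)"
  "(\<And>i. bilinear_op scale (F i)) \<Longrightarrow> delay_linear A \<Longrightarrow> delay_linear (\<lambda>y. fps_ext2 F x (A y))"
  by (rule delay_linear_compose[OF delay_linear_ext2_arg1] delay_linear_compose[OF delay_linear_ext2_arg2]; assumption)+

lemma delay_linear_ext3:
  "(\<And>i. trilinear_op scale (H i)) \<Longrightarrow> delay_linear A \<Longrightarrow> delay_linear (\<lambda>x. fps_ext3 H (A x) y z)"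
  "(\<And>i. trilinear_op scale (H i)) \<Longrightarrow> delay_linear A \<Longrightarrow> delay_linear (\<lambda>y. fps_ext3 H x (A y) z)"
  "(\<And>i. trilinear_op scale (H i)) \<Longrightarrow> delay_linear A \<Longrightarrow> delay_linear (\<lambda>z. fps_ext3 H x y (A z))"
  by (rule delay_linear_compose[OF delay_linear_ext3_arg1] delay_linear_compose[OF delay_linear_ext3_arg2]
        delay_linear_compose[OF delay_linear_ext3_arg3]; assumption)+

section \<open>Values on constant series and K[[t]]-linearity\<close>

lemma fps_ext1_const:
  assumes "\<And>i. module_hom scale scale (P i)"
  shows "fps_nth (fps_ext1 P (fps_const a)) n = P n a"
proof -
  have "fps_nth (fps_ext1 P (fps_const a)) n = (\<Sum>(i, p) \<in> {(n, 0)}. P i (fps_nth (fps_const a) p))"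
    unfolding fps_ext1_nth
    by (rule sum.mono_neutral_right) (auto simp: finite_splits module_hom.zero[OF assms] split: if_split_asm)
  then show ?thesis by simp
qed

text \<open>Constant arguments leave the whole degree to the index of the map, so
  \<open>(n, 0, 0)\<close> is the only splitting that contributes.\<close>

lemma fps_ext2_const:
  assumes "\<And>i. bilinear_op scale (F i)"
  shows "fps_nth (fps_ext2 F (fps_const a) (fps_const b)) n = F n a b"
proof -
  have "fps_nth (fps_ext2 F (fps_const a) (fps_const b)) n =
      (\<Sum>(i, p, q) \<in> {(n, 0, 0)}. F i (fps_nth (fps_const a) p) (fps_nth (fps_const b) q))"
    unfolding fps_ext2_nth
    by (rule sum.mono_neutral_right) (auto simp: finite_splits bilinear_op_simps[OF assms] split: if_split_asm)
  then show ?thesis by simp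
qed

lemma fps_ext3_const:
  assumes "\<And>i. trilinear_op scale (H i)"
  shows "fps_nth (fps_ext3 H (fps_const a) (fps_const b) (fps_const c)) n = H n a b c"
proof -
  have "fps_nth (fps_ext3 H (fps_const a) (fps_const b) (fps_const c)) n =
      (\<Sum>(i, p, q, r) \<in> {(n, 0, 0, 0)}.
        H i (fps_nth (fps_const a) p) (fps_nth (fps_const b) q) (fps_nth (fps_const c) r))"
    unfolding fps_ext3_nth
    by (rule sum.mono_neutral_right) (auto simp: finite_splits trilinear_op_simps[OF assms] split: if_split_asm)
  then show ?thesis by simp
qed

lemma delay_linear_fps_scale:
  "delay_linear (fps_scale scale c)" "delay_linear (\<lambda>c. fps_scale scale c x)"
proof -
  interpret L: module "fps_scale scale" by (rule module_fps_scale) (rule module_axioms)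
  show "delay_linear (fps_scale scale c)"
  proof (rule delay_linearI)
    show "fps_scale scale c (x + y) = fps_scale scale c x + fps_scale scale c y" for x y
      by (rule L.scale_right_distrib)
    show "fps_nth (fps_scale scale c (fps_delay x)) 0 = 0" for x
      by (simp add: fps_scale_def)
    show "fps_nth (fps_scale scale c (fps_delay x)) (Suc n) = fps_nth (fps_scale scale c x) n" for x n
      by (simp add: fps_scale_def Suc_diff_le)
  qed
  show "delay_linear (\<lambda>c. fps_scale scale c x)"
  proof (rule delay_linearI)
    show "fps_scale scale (c + d) x = fps_scale scale c x + fps_scale scale d x" for c d
      by (rule L.scale_left_distrib)
    show "fps_nth (fps_scale scale (fps_delay c) x) 0 = 0" for c
      by (simp add: fps_scale_def)
    show "fps_nth (fps_scale scale (fps_delay c) x) (Suc n) = fps_nth (fps_scale scale c x) n" for c n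
      by (simp add: fps_scale_def sum.atMost_Suc_shift del: sum.atMost_Suc)
  qed
qed

lemma fps_scale_const: "fps_nth (fps_scale scale (fps_const c) x) n = scale c (fps_nth x n)"
proof -
  have "fps_nth (fps_scale scale (fps_const c) x) n =
      (\<Sum>i\<in>{0}. scale (fps_nth (fps_const c) i) (fps_nth x (n - i)))"
    unfolding fps_scale_def fps_nth_Abs_fps by (rule sum.mono_neutral_right) auto
  then show ?thesis by simp
qed

text \<open>Homogeneity is checked in the scalar: for fixed \<open>x\<close> both sides commute with
  \<open>t\<close> as functions of \<open>c\<close>, so a constant \<open>c\<close> suffices, and
  there it is K-linearity of each \<open>P i\<close>, coefficient by coefficient.\<close>

lemma module_hom_fps_ext1:
  assumes P: "\<And>i. module_hom scale scale (P i)"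
  shows "module_hom (fps_scale scale) (fps_scale scale) (fps_ext1 P)"
  unfolding module_hom_iff
proof (intro conjI allI)
  show "module (fps_scale scale)" "module (fps_scale scale)"
    by (rule module_fps_scale, rule module_axioms)+
  have lin: "delay_linear (fps_ext1 P)" by (rule delay_linear_ext1_arg) (rule P)
  show "fps_ext1 P (x + y) = fps_ext1 P x + fps_ext1 P y" for x y
    by (rule delay_linear_add[OF lin])
  show "fps_ext1 P (fps_scale scale c x) = fps_scale scale c (fps_ext1 P x)" for c x
  proof (rule delay_linear_eqI[where x = c])
    show "delay_linear (\<lambda>c. fps_ext1 P (fps_scale scale c x))"
      by (rule delay_linear_compose[OF lin delay_linear_fps_scale(2)])
    show "delay_linear (\<lambda>c. fps_scale scale c (fps_ext1 P x))"
      by (rule delay_linear_fps_scale(2))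
    show "fps_ext1 P (fps_scale scale (fps_const c) x) =
        fps_scale scale (fps_const c) (fps_ext1 P x)" for c
      by (rule fps_ext)
         (simp add: fps_ext1_nth fps_scale_const module_hom.scale[OF P] scale_sum_right
            case_prod_unfold)
  qed
qed

end

section \<open>Invertibility of formal maps with leading term the identity\<close>

fun fps_ext1_preimage :: "(nat \<Rightarrow> 'l \<Rightarrow> 'l) \<Rightarrow> 'l::ab_group_add fps \<Rightarrow> nat \<Rightarrow> 'l" where
  "fps_ext1_preimage P y n = fps_nth y n - (\<Sum>p<n. P (n - p) (fps_ext1_preimage P y p))"

text \<open>Separating the term of \<open>P 0\<close> shows that \<open>fps_ext1 P x = y\<close> is
  a triangular system with identity diagonal. Injectivity follows by strong induction on the
  coefficient, and \<open>fps_ext1_preimage\<close> solves the system by forward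
  substitution.\<close>

lemma fps_ext1_nth_lessThan:
  assumes "P 0 = id"
  shows "fps_nth (fps_ext1 P x) n = fps_nth x n + (\<Sum>p<n. P (n - p) (fps_nth x p))"
proof -
  have "fps_nth (fps_ext1 P x) n = (\<Sum>p\<in>{..n}. P (n - p) (fps_nth x p))"
    unfolding fps_ext1_nth
    by (rule sum.reindex_bij_witness[where j = snd and i = "\<lambda>p. (n - p, p)"]) auto
  then show ?thesis by (simp add: lessThan_Suc_atMost[symmetric] assms add.commute)
qed

lemma bij_fps_ext1:
  assumes "P 0 = id"
  shows "bij (fps_ext1 P)"
proof (rule bijI)
  show "inj (fps_ext1 P)"
  proof (rule injI, rule fps_ext)
    fix x y n
    assume eq: "fps_ext1 P x = fps_ext1 P y"
    show "fps_nth x n = fps_nth y n"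
    proof (induction n rule: less_induct)
      case (less n)
      then have "(\<Sum>p<n. P (n - p) (fps_nth x p)) = (\<Sum>p<n. P (n - p) (fps_nth y p))"
        by (intro sum.cong) auto
      then show ?case
        using arg_cong[OF eq, of "\<lambda>z. fps_nth z n"] by (simp add: fps_ext1_nth_lessThan assms)
    qed
  qed
  show "surj (fps_ext1 P)"
  proof (rule surjI)
    show "fps_ext1 P (Abs_fps (fps_ext1_preimage P y)) = y" for y
    proof (rule fps_ext)
      fix n
      show "fps_nth (fps_ext1 P (Abs_fps (fps_ext1_preimage P y))) n = fps_nth y n"
        by (subst fps_ext1_nth_lessThan) (simp_all add: assms fps_ext1_preimage.simps[of P y n]
            del: fps_ext1_preimage.simps)
    qed
  qed
qed

section \<open>The null deformation\<close>

context equivariant_lie_yamaguti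
begin

lemma null_br_bilinear: "bilinear_op scale (null_br i)"
  using br_bilinear by (simp add: null_br_def bilinear_op_iff)

lemma null_tr_trilinear: "trilinear_op scale (null_tr i)"
  using tr_trilinear by (simp add: null_tr_def trilinear_op_iff)

abbreviation br_t :: "'l fps \<Rightarrow> 'l fps \<Rightarrow> 'l fps" where "br_t \<equiv> fps_ext2 null_br"
abbreviation tr_t :: "'l fps \<Rightarrow> 'l fps \<Rightarrow> 'l fps \<Rightarrow> 'l fps" where "tr_t \<equiv> fps_ext3 null_tr"

lemmas delay_linear_br_t [delay_linear_intros] = delay_linear_ext2[of null_br, OF null_br_bilinear]
lemmas delay_linear_tr_t [delay_linear_intros] = delay_linear_ext3[of null_tr, OF null_tr_trilinear]

lemmas br_t_linear = delay_linear_br_t[OF delay_linear_id]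
lemmas tr_t_linear = delay_linear_tr_t[OF delay_linear_id]

lemma br_t_const: "br_t (fps_const a) (fps_const b) = fps_const (br a b)"
  by (rule fps_ext) (simp add: fps_ext2_const null_br_bilinear, simp add: null_br_def)

lemma tr_t_const: "tr_t (fps_const a) (fps_const b) (fps_const c) = fps_const (tr a b c)"
  by (rule fps_ext) (simp add: fps_ext3_const null_tr_trilinear, simp add: null_tr_def)

text \<open>The identities of L carry over to L[[t]]: both sides are delay-linear in each argument,
  so the arguments are made constant one after another, and on constants \<open>br_t\<close> and
  \<open>tr_t\<close> are \<open>br\<close> and \<open>tr\<close>. The next three lemmas follow the
  same scheme.\<close>

lemma br_t_LY1: "br_t x y = - br_t y x"
proof (rule delay_linear_eqI[where x = x]; (intro delay_linear_intros)?)
  show "br_t (fps_const a) y = - br_t y (fps_const a)" for a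
    by (rule delay_linear_eqI[where x = y]; (intro delay_linear_intros)?)
       (simp only: br_t_const LY1[of a] fps_const_uminus)
qed

lemma tr_t_LY2: "tr_t x y z = - tr_t y x z"
proof (rule delay_linear_eqI[where x = x]; (intro delay_linear_intros)?)
  show "tr_t (fps_const a) y z = - tr_t y (fps_const a) z" for a
  proof (rule delay_linear_eqI[where x = y]; (intro delay_linear_intros)?)
    show "tr_t (fps_const a) (fps_const b) z = - tr_t (fps_const b) (fps_const a) z" for b
      by (rule delay_linear_eqI[where x = z]; (intro delay_linear_intros)?)
         (simp only: tr_t_const LY2[of a] fps_const_uminus)
  qed
qed

lemma br_tr_t_LY5: "tr_t x y (br_t u v) = br_t (tr_t x y u) v + br_t u (tr_t x y v)"
proof (rule delay_linear_eqI[where x = x]; (intro delay_linear_intros)?)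
  fix a :: 'l
  show "tr_t (fps_const a) y (br_t u v) =
      br_t (tr_t (fps_const a) y u) v + br_t u (tr_t (fps_const a) y v)"
  proof (rule delay_linear_eqI[where x = y]; (intro delay_linear_intros)?)
    fix b :: 'l
    show "tr_t (fps_const a) (fps_const b) (br_t u v) =
      br_t (tr_t (fps_const a) (fps_const b) u) v + br_t u (tr_t (fps_const a) (fps_const b) v)"
    proof (rule delay_linear_eqI[where x = u]; (intro delay_linear_intros)?)
      fix c :: 'l
      show "tr_t (fps_const a) (fps_const b) (br_t (fps_const c) v) =
        br_t (tr_t (fps_const a) (fps_const b) (fps_const c)) v
        + br_t (fps_const c) (tr_t (fps_const a) (fps_const b) v)"
        by (rule delay_linear_eqI[where x = v]; (intro delay_linear_intros)?)
           (simp add: br_t_const tr_t_const LY5)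
    qed
  qed
qed

lemma tr_t_LY6:
  "tr_t x y (tr_t u v w) = tr_t (tr_t x y u) v w + tr_t u (tr_t x y v) w + tr_t u v (tr_t x y w)"
proof (rule delay_linear_eqI[where x = x]; (intro delay_linear_intros)?)
  fix a :: 'l
  let ?a = "fps_const a"
  show "tr_t ?a y (tr_t u v w) =
      tr_t (tr_t ?a y u) v w + tr_t u (tr_t ?a y v) w + tr_t u v (tr_t ?a y w)"
  proof (rule delay_linear_eqI[where x = y]; (intro delay_linear_intros)?)
    fix b :: 'l
    let ?b = "fps_const b"
    show "tr_t ?a ?b (tr_t u v w) =
        tr_t (tr_t ?a ?b u) v w + tr_t u (tr_t ?a ?b v) w + tr_t u v (tr_t ?a ?b w)"
    proof (rule delay_linear_eqI[where x = u]; (intro delay_linear_intros)?)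
      fix c :: 'l
      let ?c = "fps_const c"
      show "tr_t ?a ?b (tr_t ?c v w) =
          tr_t (tr_t ?a ?b ?c) v w + tr_t ?c (tr_t ?a ?b v) w + tr_t ?c v (tr_t ?a ?b w)"
      proof (rule delay_linear_eqI[where x = v]; (intro delay_linear_intros)?)
        fix d :: 'l
        let ?d = "fps_const d"
        show "tr_t ?a ?b (tr_t ?c ?d w) =
            tr_t (tr_t ?a ?b ?c) ?d w + tr_t ?c (tr_t ?a ?b ?d) w + tr_t ?c ?d (tr_t ?a ?b w)"
          by (rule delay_linear_eqI[where x = w]; (intro delay_linear_intros)?)
             (simp add: tr_t_const LY6[of a b c d])
      qed
    qed
  qed
qed

section \<open>Lowest-order coefficients of the null operations\<close>

lemma br_t_nth_0: "fps_nth (br_t x y) 0 = br (fps_nth x 0) (fps_nth y 0)"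
proof -
  have "{(i, p, q). i + p + q = (0::nat)} = {(0, 0, 0)}" by auto
  then show ?thesis by (simp only: fps_ext2_nth) (simp add: null_br_def)
qed

lemma tr_t_nth_0: "fps_nth (tr_t x y z) 0 = tr (fps_nth x 0) (fps_nth y 0) (fps_nth z 0)"
proof -
  have "{(i, p, q, r). i + p + q + r = (0::nat)} = {(0, 0, 0, 0)}" by auto
  then show ?thesis by (simp only: fps_ext3_nth) (simp add: null_tr_def)
qed

text \<open>The factor t^n comes out of the argument that carries it, and coefficient
  \<open>n\<close> then sees only the constant coefficient of the other one.\<close>

lemma br_t_nth_high_order:
  "(\<And>k. k < n \<Longrightarrow> fps_nth x k = 0) \<Longrightarrow> fps_nth (br_t x y) n = br (fps_nth x n) (fps_nth y 0)"
  "(\<And>k. k < n \<Longrightarrow> fps_nth y k = 0) \<Longrightarrow> fps_nth (br_t x y) n = br (fps_nth x 0) (fps_nth y n)"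
  using delay_linear_nth_high_order[of "\<lambda>x. br_t x y" n x]
    delay_linear_nth_high_order[of "\<lambda>y. br_t x y" n y]
  by (simp_all add: br_t_nth_0 br_t_linear)

lemma tr_t_nth_high_order:
  "(\<And>k. k < n \<Longrightarrow> fps_nth x k = 0) \<Longrightarrow>
    fps_nth (tr_t x y z) n = tr (fps_nth x n) (fps_nth y 0) (fps_nth z 0)"
  "(\<And>k. k < n \<Longrightarrow> fps_nth y k = 0) \<Longrightarrow>
    fps_nth (tr_t x y z) n = tr (fps_nth x 0) (fps_nth y n) (fps_nth z 0)"
  "(\<And>k. k < n \<Longrightarrow> fps_nth z k = 0) \<Longrightarrow>
    fps_nth (tr_t x y z) n = tr (fps_nth x 0) (fps_nth y 0) (fps_nth z n)"
  using delay_linear_nth_high_order[of "\<lambda>x. tr_t x y z" n x]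
    delay_linear_nth_high_order[of "\<lambda>y. tr_t x y z" n y]
    delay_linear_nth_high_order[of "\<lambda>z. tr_t x y z" n z]
  by (simp_all add: tr_t_nth_0 tr_t_linear)

text \<open>The arguments are changed one at a time. The first change still has \<open>y'\<close> in
  the second place, but \<open>0 < n\<close> gives it the constant coefficient of \<open>y\<close>;
  hence no mixed term in the two increments appears.\<close>

lemma br_t_nth_perturb:
  assumes "\<And>k. k < n \<Longrightarrow> fps_nth x' k = fps_nth x k" "\<And>k. k < n \<Longrightarrow> fps_nth y' k = fps_nth y k"
    and "0 < n"
  shows "fps_nth (br_t x' y') n = fps_nth (br_t x y) n
    + br (fps_nth x' n - fps_nth x n) (fps_nth y 0) + br (fps_nth x 0) (fps_nth y' n - fps_nth y n)"
proof -
  have "fps_nth (br_t x' y') n =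
      fps_nth (br_t x y') n + br (fps_nth x' n - fps_nth x n) (fps_nth y' 0)"
    using delay_linear_nth_perturb[of "\<lambda>x. br_t x y'" n x' x] assms
    by (simp add: br_t_nth_0 br_t_linear)
  moreover have "fps_nth (br_t x y') n =
      fps_nth (br_t x y) n + br (fps_nth x 0) (fps_nth y' n - fps_nth y n)"
    using delay_linear_nth_perturb[of "\<lambda>y. br_t x y" n y' y] assms
    by (simp add: br_t_nth_0 br_t_linear)
  ultimately show ?thesis using assms by (simp add: algebra_simps)
qed

lemma tr_t_nth_perturb:
  assumes "\<And>k. k < n \<Longrightarrow> fps_nth x' k = fps_nth x k" "\<And>k. k < n \<Longrightarrow> fps_nth y' k = fps_nth y k"
    "\<And>k. k < n \<Longrightarrow> fps_nth z' k = fps_nth z k" and "0 < n"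
  shows "fps_nth (tr_t x' y' z') n = fps_nth (tr_t x y z) n
    + tr (fps_nth x' n - fps_nth x n) (fps_nth y 0) (fps_nth z 0)
    + tr (fps_nth x 0) (fps_nth y' n - fps_nth y n) (fps_nth z 0)
    + tr (fps_nth x 0) (fps_nth y 0) (fps_nth z' n - fps_nth z n)"
proof -
  have "fps_nth (tr_t x' y' z') n = fps_nth (tr_t x y' z') n
      + tr (fps_nth x' n - fps_nth x n) (fps_nth y' 0) (fps_nth z' 0)"
    using delay_linear_nth_perturb[of "\<lambda>x. tr_t x y' z'" n x' x] assms
    by (simp add: tr_t_nth_0 tr_t_linear)
  moreover have "fps_nth (tr_t x y' z') n = fps_nth (tr_t x y z') n
      + tr (fps_nth x 0) (fps_nth y' n - fps_nth y n) (fps_nth z' 0)"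
    using delay_linear_nth_perturb[of "\<lambda>y. tr_t x y z'" n y' y] assms
    by (simp add: tr_t_nth_0 tr_t_linear)
  moreover have "fps_nth (tr_t x y z') n = fps_nth (tr_t x y z) n
      + tr (fps_nth x 0) (fps_nth y 0) (fps_nth z' n - fps_nth z n)"
    using delay_linear_nth_perturb[of "\<lambda>z. tr_t x y z" n z' z] assms
    by (simp add: tr_t_nth_0 tr_t_linear)
  ultimately show ?thesis using assms by (simp add: algebra_simps)
qed

section \<open>Defect of a formal map from a deformation to the null one\<close>

definition defect_br ::
  "(nat \<Rightarrow> 'l \<Rightarrow> 'l \<Rightarrow> 'l) \<Rightarrow> (nat \<Rightarrow> 'l \<Rightarrow> 'l) \<Rightarrow> 'l fps \<Rightarrow> 'l fps \<Rightarrow> 'l fps" where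
  "defect_br f \<phi> x y = fps_ext1 \<phi> (fps_ext2 f x y) - br_t (fps_ext1 \<phi> x) (fps_ext1 \<phi> y)"

definition defect_tr ::
  "(nat \<Rightarrow> 'l \<Rightarrow> 'l \<Rightarrow> 'l \<Rightarrow> 'l) \<Rightarrow> (nat \<Rightarrow> 'l \<Rightarrow> 'l) \<Rightarrow> 'l fps \<Rightarrow> 'l fps \<Rightarrow> 'l fps \<Rightarrow> 'l fps" where
  "defect_tr g \<phi> x y z =
     fps_ext1 \<phi> (fps_ext3 g x y z) - tr_t (fps_ext1 \<phi> x) (fps_ext1 \<phi> y) (fps_ext1 \<phi> z)"

text \<open>Evaluation at constants turns the coefficient of t^n into a map on L, the candidate
  cochain. Since the defect is delay-linear in each argument, these maps together determine it on
  all of L[[t]].\<close>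

definition defect_br_coeff ::
  "(nat \<Rightarrow> 'l \<Rightarrow> 'l \<Rightarrow> 'l) \<Rightarrow> (nat \<Rightarrow> 'l \<Rightarrow> 'l) \<Rightarrow> nat \<Rightarrow> 'l \<Rightarrow> 'l \<Rightarrow> 'l" where
  "defect_br_coeff f \<phi> n a b = fps_nth (defect_br f \<phi> (fps_const a) (fps_const b)) n"

definition defect_tr_coeff ::
  "(nat \<Rightarrow> 'l \<Rightarrow> 'l \<Rightarrow> 'l \<Rightarrow> 'l) \<Rightarrow> (nat \<Rightarrow> 'l \<Rightarrow> 'l) \<Rightarrow> nat \<Rightarrow> 'l \<Rightarrow> 'l \<Rightarrow> 'l \<Rightarrow> 'l" where
  "defect_tr_coeff g \<phi> n a b c =
     fps_nth (defect_tr g \<phi> (fps_const a) (fps_const b) (fps_const c)) n"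

text \<open>Order \<open>n\<close> of the defect reads only the indices up to \<open>n\<close> of
  the formal map. This protects the orders already settled when a later coefficient is chosen, and
  it permits the passage to the limit.\<close>

lemma defect_br_coeff_cong:
  assumes "\<And>i. i \<le> n \<Longrightarrow> \<phi> i = \<phi>' i"
  shows "defect_br_coeff f \<phi> n = defect_br_coeff f \<phi>' n"
  unfolding defect_br_coeff_def defect_br_def fps_sub_nth
  by (intro ext arg_cong2[of _ _ _ _ "(-)"] fps_ext1_nth_cong fps_ext2_nth_cong)
     (auto simp: assms intro: fps_ext1_nth_cong)

lemma defect_tr_coeff_cong:
  assumes "\<And>i. i \<le> n \<Longrightarrow> \<phi> i = \<phi>' i"
  shows "defect_tr_coeff g \<phi> n = defect_tr_coeff g \<phi>' n"
  unfolding defect_tr_coeff_def defect_tr_def fps_sub_nth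
  by (intro ext arg_cong2[of _ _ _ _ "(-)"] fps_ext1_nth_cong fps_ext3_nth_cong)
     (auto simp: assms intro: fps_ext1_nth_cong)

text \<open>The class of \<open>(F, E)\<close> must be that of 0, so \<open>(F, E)\<close> is
  related to 0. The relation yields a primitive of the negative of \<open>(F, E)\<close>, whence the
  witness is the negative of the map obtained.\<close>

lemma Z23_imp_coboundary:
  assumes H: "H23 = {H23_zero}" and z: "(F, E) \<in> Z23"
  obtains h where "h \<in> C1" "F = delta1_I h" "E = delta1_II h"
proof -
  have zero_C1: "(\<lambda>x. 0) \<in> C1"
    using module_hom.zero[OF act_linear]
    by (auto simp: C1_def equivariant1_def module_hom_iff module_axioms)
  have "delta1_I (\<lambda>x. 0) = 0" "delta1_II (\<lambda>x. 0) = 0"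
    using bilinear_op_simps(1,2)[OF br_bilinear] trilinear_op_simps(1-3)[OF tr_trilinear]
    by (simp_all add: delta1_I_def delta1_II_def fun_eq_iff)
  \<comment> \<open>The zero coboundary makes \<open>cohomologous\<close> reflexive on cocycles, so
    that a cocycle belongs to its own class.\<close>
  then have zero_B: "(0, 0) \<in> B23"
    unfolding B23_def using zero_C1 by (intro CollectI exI[of _ "\<lambda>x. 0"]) simp
  have "cohomologous `` {(F, E)} \<in> H23"
    unfolding H23_def using z by (rule quotientI)
  then have "cohomologous `` {(F, E)} = cohomologous `` {0}"
    using H by (simp add: H23_zero_def)
  moreover have "((F, E), (F, E)) \<in> cohomologous"
    using z zero_B by (simp add: cohomologous_def zero_prod_def)
  ultimately have "(0, (F, E)) \<in> cohomologous" by blast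
  then have "0 - (F, E) \<in> B23" unfolding cohomologous_def by blast
  then obtain h where h: "h \<in> C1" "0 - F = delta1_I h" "0 - E = delta1_II h"
    unfolding B23_def zero_prod_def diff_Pair by blast
  have F: "F x y = - delta1_I h x y" and E: "E x y z = - delta1_II h x y z" for x y z
    by (simp_all flip: h(2,3))
  have lin: "module_hom scale scale h" and equi: "equivariant1 h"
    using h by (auto simp: C1_def)
  have br_minus: "br a (- b) = - br a b" for a b
    using bilinear_op_add_right[OF br_bilinear, of a b "-b"] bilinear_op_zero_right[OF br_bilinear]
    by (simp add: eq_neg_iff_add_eq_0 add.commute)
  have tr_minus: "tr (- a) b c = - tr a b c" "tr a b (- c) = - tr a b c" for a b c
    using trilinear_op_add1[OF tr_trilinear, of a "-a" b c] trilinear_op_zero1[OF tr_trilinear]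
      trilinear_op_add3[OF tr_trilinear, of a b c "-c"] trilinear_op_zero3[OF tr_trilinear]
    by (simp_all add: eq_neg_iff_add_eq_0 add.commute)
  show ?thesis
  proof
    show "(\<lambda>x. - h x) \<in> C1"
      using lin equi module_hom.neg[OF act_linear]
      by (auto simp: C1_def equivariant1_def module_hom_iff)
    show "F = delta1_I (\<lambda>x. - h x)"
      by (simp add: fun_eq_iff F delta1_I_def br_minus)
    show "E = delta1_II (\<lambda>x. - h x)"
      by (simp add: fun_eq_iff E delta1_II_def tr_minus)
  qed
qed

context
  fixes f :: "nat \<Rightarrow> 'l \<Rightarrow> 'l \<Rightarrow> 'l" and g :: "nat \<Rightarrow> 'l \<Rightarrow> 'l \<Rightarrow> 'l \<Rightarrow> 'l"
  assumes deformation: "equivariant_deformation f g"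
begin

interpretation def: lie_yamaguti "fps_scale scale" "fps_ext2 f" "fps_ext3 g"
  using deformation by (simp add: equivariant_deformation_def)

lemma f_bilinear: "bilinear_op scale (f i)"
  and g_trilinear: "trilinear_op scale (g i)"
  and f_0: "f 0 = br" and g_0: "g 0 = tr"
  using deformation by (simp_all add: equivariant_deformation_def)

text \<open>A deformation demands equivariance from index 1 on; at index 0 the compatibility of the
  action with \<open>br\<close> and \<open>tr\<close> provides it.\<close>

lemma f_equivariant: "equivariant2 (f i)" and g_equivariant: "equivariant3 (g i)"
proof -
  show "equivariant2 (f i)"
    using deformation act_br by (cases i) (auto simp: equivariant_deformation_def equivariant2_def)
  show "equivariant3 (g i)"
    using deformation act_tr by (cases i) (auto simp: equivariant_deformation_def equivariant3_def)
qed

lemmas delay_linear_f [delay_linear_intros] = delay_linear_ext2[of f, OF f_bilinear]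
lemmas delay_linear_g [delay_linear_intros] = delay_linear_ext3[of g, OF g_trilinear]

section \<open>Defect identities for a formal map with leading term the identity\<close>

context
  fixes \<phi> :: "nat \<Rightarrow> 'l \<Rightarrow> 'l"
  assumes phi_C1: "\<And>i. \<phi> i \<in> C1" and phi_0: "\<phi> 0 = id"
begin

lemma phi_linear: "module_hom scale scale (\<phi> i)"
  using phi_C1 by (simp add: C1_def)

lemma phi_equivariant: "equivariant1 (\<phi> i)"
  using phi_C1 by (simp add: C1_def)

lemmas delay_linear_phi [delay_linear_intros] = delay_linear_ext1[of \<phi>, OF phi_linear]

lemma delay_linear_defect_br [delay_linear_intros]:
  "delay_linear A \<Longrightarrow> delay_linear (\<lambda>x. defect_br f \<phi> (A x) y)"
  "delay_linear A \<Longrightarrow> delay_linear (\<lambda>y. defect_br f \<phi> x (A y))"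
  unfolding defect_br_def by (intro delay_linear_intros; assumption)+

lemma delay_linear_defect_tr [delay_linear_intros]:
  "delay_linear A \<Longrightarrow> delay_linear (\<lambda>x. defect_tr g \<phi> (A x) y z)"
  "delay_linear A \<Longrightarrow> delay_linear (\<lambda>y. defect_tr g \<phi> x (A y) z)"
  "delay_linear A \<Longrightarrow> delay_linear (\<lambda>z. defect_tr g \<phi> x y (A z))"
  unfolding defect_tr_def by (intro delay_linear_intros; assumption)+

lemma phi_nth_0: "fps_nth (fps_ext1 \<phi> x) 0 = fps_nth x 0"
  by (simp add: fps_ext1_nth_lessThan phi_0)

lemma phi_add: "fps_ext1 \<phi> (x + y) = fps_ext1 \<phi> x + fps_ext1 \<phi> y"
  by (rule delay_linear_add) (intro delay_linear_intros)

lemma phi_neg: "fps_ext1 \<phi> (- x) = - fps_ext1 \<phi> x"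
  by (rule delay_linear_uminus) (intro delay_linear_intros)

lemma br_t_diff: "br_t (x - x') y = br_t x y - br_t x' y" "br_t x (y - y') = br_t x y - br_t x y'"
  using delay_linear_diff[of "\<lambda>x. br_t x y"] delay_linear_diff[of "\<lambda>y. br_t x y"]
  by (simp_all add: br_t_linear)

lemma tr_t_diff: "tr_t (x - x') y z = tr_t x y z - tr_t x' y z"
  "tr_t x (y - y') z = tr_t x y z - tr_t x y' z"
  "tr_t x y (z - z') = tr_t x y z - tr_t x y z'"
  using delay_linear_diff[of "\<lambda>x. tr_t x y z"] delay_linear_diff[of "\<lambda>y. tr_t x y z"]
    delay_linear_diff[of "\<lambda>z. tr_t x y z"]
  by (simp_all add: tr_t_linear)

text \<open>The deformed and the null bracket are both skew. Away from characteristic 2 this becomes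
  the alternating condition on the cochain.\<close>

lemma defect_LY1: "defect_br f \<phi> x y = - defect_br f \<phi> y x"
  unfolding defect_br_def def.LY1[of x y] phi_neg
  by (subst br_t_LY1) simp

lemma defect_LY2: "defect_tr g \<phi> x y z = - defect_tr g \<phi> y x z"
  unfolding defect_tr_def def.LY2[of x y z] phi_neg
  by (subst tr_t_LY2) simp

text \<open>Subtract (LY5) for the null operations at the images under \<open>\<phi>\<close> from
  the image of (LY5) for \<open>f\<close> and \<open>g\<close>. Each nested term differs from its
  counterpart in two steps, the defect of the outer operation and the null operation applied to the
  defect of the inner one. The identity is exact at all orders; (LY6) is treated likewise
  next.\<close>

lemma defect_LY5:
  "defect_tr g \<phi> x y (fps_ext2 f u v) + tr_t (fps_ext1 \<phi> x) (fps_ext1 \<phi> y) (defect_br f \<phi> u v) =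
    defect_br f \<phi> (fps_ext3 g x y u) v + br_t (defect_tr g \<phi> x y u) (fps_ext1 \<phi> v)
    + defect_br f \<phi> u (fps_ext3 g x y v) + br_t (fps_ext1 \<phi> u) (defect_tr g \<phi> x y v)"
  unfolding defect_br_def defect_tr_def br_t_diff tr_t_diff def.LY5 phi_add br_tr_t_LY5
  by (simp add: algebra_simps)

lemma defect_LY6:
  "defect_tr g \<phi> x y (fps_ext3 g u v w)
    + tr_t (fps_ext1 \<phi> x) (fps_ext1 \<phi> y) (defect_tr g \<phi> u v w) =
    defect_tr g \<phi> (fps_ext3 g x y u) v w
    + tr_t (defect_tr g \<phi> x y u) (fps_ext1 \<phi> v) (fps_ext1 \<phi> w)
    + defect_tr g \<phi> u (fps_ext3 g x y v) w
    + tr_t (fps_ext1 \<phi> u) (defect_tr g \<phi> x y v) (fps_ext1 \<phi> w)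
    + defect_tr g \<phi> u v (fps_ext3 g x y w)
    + tr_t (fps_ext1 \<phi> u) (fps_ext1 \<phi> v) (defect_tr g \<phi> x y w)"
  unfolding defect_tr_def tr_t_diff def.LY6[of x y] phi_add
    tr_t_LY6[of "fps_ext1 \<phi> x" "fps_ext1 \<phi> y"]
  by (simp add: algebra_simps)

section \<open>Defect coefficients as equivariant cochains and cocycles\<close>

lemma defect_br_coeff_eq:
  "defect_br_coeff f \<phi> n a b = (\<Sum>(i, p) \<in> {(i, p). i + p = n}. \<phi> i (f p a b))
     - (\<Sum>(i, p, q) \<in> {(i, p, q). i + p + q = n}. null_br i (\<phi> p a) (\<phi> q b))"
  by (simp add: defect_br_coeff_def defect_br_def fps_ext1_nth[of _ "fps_ext2 f _ _"]
      fps_ext2_nth[of null_br] fps_ext2_const f_bilinear fps_ext1_const phi_linear)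

lemma defect_tr_coeff_eq:
  "defect_tr_coeff g \<phi> n a b c = (\<Sum>(i, p) \<in> {(i, p). i + p = n}. \<phi> i (g p a b c))
     - (\<Sum>(i, p, q, r) \<in> {(i, p, q, r). i + p + q + r = n}. null_tr i (\<phi> p a) (\<phi> q b) (\<phi> r c))"
  by (simp add: defect_tr_coeff_def defect_tr_def fps_ext1_nth[of _ "fps_ext3 g _ _ _"]
      fps_ext3_nth[of null_tr] fps_ext3_const g_trilinear fps_ext1_const phi_linear)

lemma defect_br_coeff_bilinear: "bilinear_op scale (defect_br_coeff f \<phi> n)"
  unfolding bilinear_op_iff
  by (simp add: defect_br_coeff_eq module_hom.add[OF phi_linear] module_hom.scale[OF phi_linear]
      bilinear_op_simps[OF f_bilinear] bilinear_op_simps[OF null_br_bilinear] sum.distrib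
      case_prod_unfold scale_sum_right scale_right_diff_distrib)

lemma defect_tr_coeff_trilinear: "trilinear_op scale (defect_tr_coeff g \<phi> n)"
  unfolding trilinear_op_iff
  by (simp add: defect_tr_coeff_eq module_hom.add[OF phi_linear] module_hom.scale[OF phi_linear]
      trilinear_op_simps[OF g_trilinear] trilinear_op_simps[OF null_tr_trilinear] sum.distrib
      case_prod_unfold scale_sum_right scale_right_diff_distrib)

lemma defect_br_coeff_equivariant: "equivariant2 (defect_br_coeff f \<phi> n)"
  unfolding equivariant2_def
proof (intro ballI allI)
  fix \<sigma> x y assume \<sigma>: "\<sigma> \<in> carrier G"
  note lin = act_linear[OF \<sigma>]
  \<comment> \<open>At index 0 this is compatibility of the action with the bracket; elsewhere both
    sides are 0, by linearity of \<open>act \<sigma>\<close>.\<close>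
  have "null_br i (act \<sigma> a) (act \<sigma> b) = act \<sigma> (null_br i a b)" for i a b
    using act_br[OF \<sigma>] by (simp add: null_br_def module_hom.zero[OF lin])
  then show "defect_br_coeff f \<phi> n (act \<sigma> x) (act \<sigma> y) = act \<sigma> (defect_br_coeff f \<phi> n x y)"
    using \<sigma> f_equivariant phi_equivariant
    by (simp add: defect_br_coeff_eq equivariant2_def equivariant1_def case_prod_unfold
        module_hom.sum[OF lin] module_hom.diff[OF lin])
qed

lemma defect_tr_coeff_equivariant: "equivariant3 (defect_tr_coeff g \<phi> n)"
  unfolding equivariant3_def
proof (intro ballI allI)
  fix \<sigma> x y z assume \<sigma>: "\<sigma> \<in> carrier G"
  note lin = act_linear[OF \<sigma>]
  have "null_tr i (act \<sigma> a) (act \<sigma> b) (act \<sigma> c) = act \<sigma> (null_tr i a b c)" for i a b c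
    using act_tr[OF \<sigma>] by (simp add: null_tr_def module_hom.zero[OF lin])
  then show "defect_tr_coeff g \<phi> n (act \<sigma> x) (act \<sigma> y) (act \<sigma> z) =
      act \<sigma> (defect_tr_coeff g \<phi> n x y z)"
    using \<sigma> g_equivariant phi_equivariant
    by (simp add: defect_tr_coeff_eq equivariant3_def equivariant1_def case_prod_unfold
        module_hom.sum[OF lin] module_hom.diff[OF lin])
qed

text \<open>Take coefficient \<open>n\<close> of the defect identities at constant arguments. As the
  defects vanish below order \<open>n\<close>, everything multiplying or entering them counts only
  to order 0, where \<open>f\<close>, \<open>g\<close> and \<open>\<phi>\<close> are
  \<open>br\<close>, \<open>tr\<close> and the identity; the linear cocycle identities
  remain.\<close>

lemma leading_defect_cocycle:
  assumes char: "CHAR('k) \<noteq> 2"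
    and br_low: "\<And>k. k < n \<Longrightarrow> defect_br_coeff f \<phi> k = (\<lambda>_ _. 0)"
    and tr_low: "\<And>k. k < n \<Longrightarrow> defect_tr_coeff g \<phi> k = (\<lambda>_ _ _. 0)"
  shows "(defect_br_coeff f \<phi> n, defect_tr_coeff g \<phi> n) \<in> Z23"
proof -
  let ?D = "defect_br_coeff f \<phi> n" and ?E = "defect_tr_coeff g \<phi> n"
  \<comment> \<open>A characteristic dividing 2 without being 2 would be 1, forcing 1 = 0 in the
    field.\<close>
  have two: "(2 :: 'k) \<noteq> 0"
  proof
    assume "(2 :: 'k) = 0"
    then have "CHAR('k) dvd 2" using of_nat_eq_0_iff_char_dvd[of 2, where 'a = 'k] by simp
    then have "CHAR('k) = 1"
      using char two_is_prime_nat by (auto simp: prime_nat_iff)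
    then show False using of_nat_CHAR[where 'a = 'k] by simp
  qed
  have neg_self: "v = 0" if "v = - v" for v :: 'l
  proof -
    have "scale 2 v = v + v" using scale_left_distrib[of 1 1 v] by simp
    also have "\<dots> = 0" using that by (simp add: eq_neg_iff_add_eq_0)
    finally have "scale (inverse 2) (scale 2 v) = 0" by simp
    then show ?thesis using two by simp
  qed
  have D_const_low: "fps_nth (defect_br f \<phi> (fps_const a) (fps_const b)) k = 0" if "k < n" for k a b
    using br_low[OF that] by (metis defect_br_coeff_def)
  have E_const_low: "fps_nth (defect_tr g \<phi> (fps_const a) (fps_const b) (fps_const c)) k = 0"
    if "k < n" for k a b c
    using tr_low[OF that] by (metis defect_tr_coeff_def)
  \<comment> \<open>Values of \<open>fps_ext2 f\<close> and \<open>fps_ext3 g\<close> at constants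
    need not be constant. The vanishing below order \<open>n\<close> lets the leading coefficient of
    a defect replace such an argument by its constant coefficient.\<close>
  note leading = delay_linear_nth_vanishing[where n = n]
  have D1: "fps_nth (defect_br f \<phi> x (fps_const b)) n = ?D (fps_nth x 0) b" for x b
    unfolding defect_br_coeff_def
    by (rule leading[of "\<lambda>x. defect_br f \<phi> x (fps_const b)"])
       (intro delay_linear_intros, rule D_const_low)
  have D2: "fps_nth (defect_br f \<phi> (fps_const a) y) n = ?D a (fps_nth y 0)" for a y
    unfolding defect_br_coeff_def
    by (rule leading[of "\<lambda>y. defect_br f \<phi> (fps_const a) y"])
       (intro delay_linear_intros, rule D_const_low)
  have E1: "fps_nth (defect_tr g \<phi> x (fps_const b) (fps_const c)) n = ?E (fps_nth x 0) b c" for x b c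
    unfolding defect_tr_coeff_def
    by (rule leading[of "\<lambda>x. defect_tr g \<phi> x (fps_const b) (fps_const c)"])
       (intro delay_linear_intros, rule E_const_low)
  have E2: "fps_nth (defect_tr g \<phi> (fps_const a) y (fps_const c)) n = ?E a (fps_nth y 0) c" for a y c
    unfolding defect_tr_coeff_def
    by (rule leading[of "\<lambda>y. defect_tr g \<phi> (fps_const a) y (fps_const c)"])
       (intro delay_linear_intros, rule E_const_low)
  have E3: "fps_nth (defect_tr g \<phi> (fps_const a) (fps_const b) z) n = ?E a b (fps_nth z 0)" for a b z
    unfolding defect_tr_coeff_def
    by (rule leading[of "\<lambda>z. defect_tr g \<phi> (fps_const a) (fps_const b) z"])
       (intro delay_linear_intros, rule E_const_low)
  note coeffs = D1 D2 E1 E2 E3 fps_ext2_const[of f, OF f_bilinear] fps_ext3_const[of g, OF g_trilinear]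
    f_0 g_0 phi_nth_0 D_const_low E_const_low br_t_nth_high_order tr_t_nth_high_order
  have "?E x1 x2 (br x3 x4) + tr x1 x2 (?D x3 x4) =
      ?D (tr x1 x2 x3) x4 + br (?E x1 x2 x3) x4 + ?D x3 (tr x1 x2 x4) + br x3 (?E x1 x2 x4)"
    for x1 x2 x3 x4
    using arg_cong[OF defect_LY5[of "fps_const x1" "fps_const x2" "fps_const x3" "fps_const x4"],
        of "\<lambda>x. fps_nth x n"]
    by (simp add: coeffs)
  \<comment> \<open>Skewness of \<open>br\<close> exchanges the bracket factors to match the signs
    of \<open>delta_I\<close>; (LY2) does the same for \<open>delta_II\<close> below.\<close>
  then have "delta_I ?D ?E = 0"
    by (simp add: fun_eq_iff delta_I_def LY1[of _ "?E _ _ _"] algebra_simps)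
  moreover have "?E x1 x2 (tr x3 x4 x5) + tr x1 x2 (?E x3 x4 x5) =
      ?E (tr x1 x2 x3) x4 x5 + tr (?E x1 x2 x3) x4 x5
      + ?E x3 (tr x1 x2 x4) x5 + tr x3 (?E x1 x2 x4) x5
      + ?E x3 x4 (tr x1 x2 x5) + tr x3 x4 (?E x1 x2 x5)" for x1 x2 x3 x4 x5
    using arg_cong[OF defect_LY6[of "fps_const x1" "fps_const x2" "fps_const x3" "fps_const x4"
          "fps_const x5"], of "\<lambda>x. fps_nth x n"]
    by (simp add: coeffs)
  then have "delta_II ?E = 0"
    by (simp add: fun_eq_iff delta_II_def LY2[of _ "?E _ _ _"] algebra_simps)
  moreover have "?D a a = 0" for a
    unfolding defect_br_coeff_def
    by (rule neg_self) (subst defect_LY1, rule fps_neg_nth)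
  then have "?D \<in> C2"
    by (simp add: C2_def defect_br_coeff_bilinear defect_br_coeff_equivariant)
  moreover have "?E a a b = 0" for a b
    unfolding defect_tr_coeff_def
    by (rule neg_self) (subst defect_LY2, rule fps_neg_nth)
  then have "?E \<in> C3"
    by (simp add: C3_def defect_tr_coeff_trilinear defect_tr_coeff_equivariant)
  ultimately show ?thesis by (simp add: Z23_def)
qed

text \<open>All coefficients vanish, so the defects are 0 on constants; comparison with the zero map
  then frees the arguments one by one, starting with the last.\<close>

lemma vanishing_defects_imp_hom:
  assumes "\<And>n. defect_br_coeff f \<phi> n = (\<lambda>_ _. 0)" "\<And>n. defect_tr_coeff g \<phi> n = (\<lambda>_ _ _. 0)"
  shows "fps_ext1 \<phi> (fps_ext2 f x y) = br_t (fps_ext1 \<phi> x) (fps_ext1 \<phi> y)"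
    and "fps_ext1 \<phi> (fps_ext3 g x y z) = tr_t (fps_ext1 \<phi> x) (fps_ext1 \<phi> y) (fps_ext1 \<phi> z)"
proof -
  have "defect_br f \<phi> (fps_const a) (fps_const b) = 0" for a b
    by (rule fps_ext) (use fun_cong[OF fun_cong[OF assms(1)]] in \<open>simp add: defect_br_coeff_def\<close>)
  then have const2: "defect_br f \<phi> (fps_const a) y = 0" for a y
    using delay_linear_eqI[of "defect_br f \<phi> (fps_const a)" "\<lambda>_. 0" y] delay_linear_zero
      delay_linear_defect_br(2)[OF delay_linear_id] by simp
  have "defect_br f \<phi> x y = 0"
    using delay_linear_eqI[of "\<lambda>x. defect_br f \<phi> x y" "\<lambda>_. 0" x] delay_linear_zero const2
      delay_linear_defect_br(1)[OF delay_linear_id] by simp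
  then show "fps_ext1 \<phi> (fps_ext2 f x y) = br_t (fps_ext1 \<phi> x) (fps_ext1 \<phi> y)"
    by (simp add: defect_br_def)
  have "defect_tr g \<phi> (fps_const a) (fps_const b) (fps_const c) = 0" for a b c
    by (rule fps_ext) (use fun_cong[OF fun_cong[OF fun_cong[OF assms(2)]]] in \<open>simp add: defect_tr_coeff_def\<close>)
  then have const2: "defect_tr g \<phi> (fps_const a) (fps_const b) z = 0" for a b z
    using delay_linear_eqI[of "defect_tr g \<phi> (fps_const a) (fps_const b)" "\<lambda>_. 0" z]
      delay_linear_zero delay_linear_defect_tr(3)[OF delay_linear_id] by simp
  then have const1: "defect_tr g \<phi> (fps_const a) y z = 0" for a y z
    using delay_linear_eqI[of "\<lambda>y. defect_tr g \<phi> (fps_const a) y z" "\<lambda>_. 0" y]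
      delay_linear_zero delay_linear_defect_tr(2)[OF delay_linear_id] by simp
  have "defect_tr g \<phi> x y z = 0"
    using delay_linear_eqI[of "\<lambda>x. defect_tr g \<phi> x y z" "\<lambda>_. 0" x] delay_linear_zero const1
      delay_linear_defect_tr(1)[OF delay_linear_id] by simp
  then show "fps_ext1 \<phi> (fps_ext3 g x y z) = tr_t (fps_ext1 \<phi> x) (fps_ext1 \<phi> y) (fps_ext1 \<phi> z)"
    by (simp add: defect_tr_def)
qed

section \<open>Effect of choosing the next coefficient\<close>

lemma fps_ext1_upd_nth:
  assumes "0 < n" and "\<phi> n = (\<lambda>_. 0)"
  shows "fps_nth (fps_ext1 (\<phi>(n := h)) x) n = fps_nth (fps_ext1 \<phi> x) n + h (fps_nth x 0)"
proof -
  obtain m where m: "n = Suc m" using assms(1) gr0_conv_Suc by blast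
  \<comment> \<open>After the term with p = 0 is split off, the remaining indices have the form m -
    p and never hit the updated one.\<close>
  have "m - p \<noteq> Suc m" for p by simp
  then show ?thesis
    using assms(2) phi_0
    by (simp add: fps_ext1_nth_lessThan m sum.lessThan_Suc_shift del: sum.lessThan_Suc)
qed

text \<open>Since \<open>\<phi> n\<close> was 0, the image of the product gains
  \<open>h (br a b)\<close> at order \<open>n\<close>, and the product of the images gains
  \<open>br (h a) b + br a (h b)\<close>. The difference is the negative of
  \<open>delta1_I h a b\<close> once (LY1) turns \<open>br b (h a)\<close> around; the triple
  product behaves alike through (LY2).\<close>

lemma leading_defect_upd:
  assumes n: "0 < n" and phi_n: "\<phi> n = (\<lambda>_. 0)" and h: "h \<in> C1"
  shows "defect_br_coeff f (\<phi>(n := h)) n a b = defect_br_coeff f \<phi> n a b - delta1_I h a b"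
    and "defect_tr_coeff g (\<phi>(n := h)) n a b c = defect_tr_coeff g \<phi> n a b c - delta1_II h a b c"
proof -
  let ?\<phi> = "\<phi>(n := h)"
  have upd_linear: "module_hom scale scale (?\<phi> i)" for i
    using phi_linear h by (simp add: C1_def)
  have const: "fps_nth (fps_ext1 ?\<phi> (fps_const a)) k = (if k = n then h a else \<phi> k a)" for k a
    by (simp only: fps_ext1_const[OF upd_linear]) simp
  have const_0: "fps_nth (fps_ext1 \<phi> (fps_const a)) k = \<phi> k a" for k a
    by (rule fps_ext1_const[OF phi_linear])
  have br: "fps_nth (br_t (fps_ext1 ?\<phi> (fps_const a)) (fps_ext1 ?\<phi> (fps_const b))) n =
      fps_nth (br_t (fps_ext1 \<phi> (fps_const a)) (fps_ext1 \<phi> (fps_const b))) n + br (h a) b + br a (h b)"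
    by (subst br_t_nth_perturb[where x = "fps_ext1 \<phi> (fps_const a)" and y = "fps_ext1 \<phi> (fps_const b)"])
       (use n in \<open>simp_all add: const const_0 phi_n phi_0\<close>)
  show "defect_br_coeff f ?\<phi> n a b = defect_br_coeff f \<phi> n a b - delta1_I h a b"
    unfolding defect_br_coeff_def defect_br_def fps_sub_nth br fps_ext1_upd_nth[of n h, OF n phi_n]
      fps_ext2_const[of f, OF f_bilinear] f_0 delta1_I_def LY1[of b "h a"]
    by (simp add: algebra_simps)
  have tr: "fps_nth (tr_t (fps_ext1 ?\<phi> (fps_const a)) (fps_ext1 ?\<phi> (fps_const b))
        (fps_ext1 ?\<phi> (fps_const c))) n =
      fps_nth (tr_t (fps_ext1 \<phi> (fps_const a)) (fps_ext1 \<phi> (fps_const b)) (fps_ext1 \<phi> (fps_const c))) n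
      + tr (h a) b c + tr a (h b) c + tr a b (h c)"
    by (subst tr_t_nth_perturb[where x = "fps_ext1 \<phi> (fps_const a)" and y = "fps_ext1 \<phi> (fps_const b)"
          and z = "fps_ext1 \<phi> (fps_const c)"])
       (use n in \<open>simp_all add: const const_0 phi_n phi_0\<close>)
  show "defect_tr_coeff g ?\<phi> n a b c = defect_tr_coeff g \<phi> n a b c - delta1_II h a b c"
    unfolding defect_tr_coeff_def defect_tr_def fps_sub_nth tr fps_ext1_upd_nth[of n h, OF n phi_n]
      fps_ext3_const[of g, OF g_trilinear] g_0 delta1_II_def LY2[of "h b" a c]
    by (simp add: algebra_simps)
qed

end

section \<open>Inductive construction and passage to the limit\<close>

definition partial_equivalence :: "nat \<Rightarrow> (nat \<Rightarrow> 'l \<Rightarrow> 'l) \<Rightarrow> bool" where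
  "partial_equivalence n \<phi> \<longleftrightarrow> (\<forall>i. \<phi> i \<in> C1) \<and> \<phi> 0 = id \<and> (\<forall>i>n. \<phi> i = (\<lambda>_. 0)) \<and>
     (\<forall>k\<le>n. defect_br_coeff f \<phi> k = (\<lambda>_ _. 0) \<and> defect_tr_coeff g \<phi> k = (\<lambda>_ _ _. 0))"

lemma partial_equivalence_0: "partial_equivalence 0 (\<lambda>i. if i = 0 then id else (\<lambda>_. 0))"
proof -
  let ?\<phi> = "\<lambda>i::nat. if i = 0 then id else (\<lambda>_. 0 :: 'l)"
  have "?\<phi> i \<in> C1" for i
    using module_hom.zero[OF act_linear]
    by (auto simp: C1_def equivariant1_def module_hom_iff module_axioms)
  moreover have "defect_br_coeff f ?\<phi> 0 = (\<lambda>_ _. 0)"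
    by (simp add: fun_eq_iff defect_br_coeff_def defect_br_def fps_ext1_nth_lessThan br_t_nth_0
        fps_ext2_const f_bilinear f_0)
  moreover have "defect_tr_coeff g ?\<phi> 0 = (\<lambda>_ _ _. 0)"
    by (simp add: fun_eq_iff defect_tr_coeff_def defect_tr_def fps_ext1_nth_lessThan tr_t_nth_0
        fps_ext3_const g_trilinear g_0)
  ultimately show ?thesis by (simp add: partial_equivalence_def)
qed

lemma partial_equivalence_Suc:
  assumes char: "CHAR('k) \<noteq> 2" and H: "H23 = {H23_zero}" and \<phi>: "partial_equivalence n \<phi>"
  shows "\<exists>h. partial_equivalence (Suc n) (\<phi>(Suc n := h))"
proof -
  have C1: "\<And>i. \<phi> i \<in> C1" and zero: "\<phi> 0 = id" and high: "\<And>i. i > n \<Longrightarrow> \<phi> i = (\<lambda>_. 0)"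
    and br_low: "\<And>k. k < Suc n \<Longrightarrow> defect_br_coeff f \<phi> k = (\<lambda>_ _. 0)"
    and tr_low: "\<And>k. k < Suc n \<Longrightarrow> defect_tr_coeff g \<phi> k = (\<lambda>_ _ _. 0)"
    using \<phi> by (auto simp: partial_equivalence_def)
  obtain h where h: "h \<in> C1" and br: "defect_br_coeff f \<phi> (Suc n) = delta1_I h"
    and tr: "defect_tr_coeff g \<phi> (Suc n) = delta1_II h"
    using Z23_imp_coboundary[OF H leading_defect_cocycle[OF C1 zero char br_low tr_low]] by blast
  \<comment> \<open>By \<open>high\<close> the entry at \<open>Suc n\<close> is 0 before the update,
    as \<open>leading_defect_upd\<close> requires. The update then subtracts exactly the coboundary
    that the defect was found to be.\<close>
  have upd: "defect_br_coeff f (\<phi>(Suc n := h)) (Suc n) = (\<lambda>_ _. 0)"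
    "defect_tr_coeff g (\<phi>(Suc n := h)) (Suc n) = (\<lambda>_ _ _. 0)"
    using leading_defect_upd[where \<phi> = \<phi> and n = "Suc n", OF C1 zero _ high h] by (simp_all add: fun_eq_iff br tr)
  have low: "defect_br_coeff f (\<phi>(Suc n := h)) k = (\<lambda>_ _. 0)"
    "defect_tr_coeff g (\<phi>(Suc n := h)) k = (\<lambda>_ _ _. 0)" if "k \<le> n" for k
    using defect_br_coeff_cong[of k "\<phi>(Suc n := h)" \<phi> f]
      defect_tr_coeff_cong[of k "\<phi>(Suc n := h)" \<phi> g] br_low tr_low that by auto
  have "partial_equivalence (Suc n) (\<phi>(Suc n := h))"
    unfolding partial_equivalence_def using C1 zero high h upd low by (simp add: le_Suc_eq)
  then show ?thesis by (intro exI[of _ h])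
qed

text \<open>Each stage settles one coefficient for good, so the stages have a coefficientwise limit,
  and each defect coefficient of the limit is already computed at a finite stage.\<close>

lemma deformation_trivial:
  assumes char: "CHAR('k) \<noteq> 2" and H: "H23 = {H23_zero}"
  shows "trivial_deformation f g"
proof -
  \<comment> \<open>Dependent choice, as each correction depends on the map built so far. Keeping
    the form of the update in the relation is what yields stability.\<close>
  obtain \<Phi> where \<Phi>: "\<And>n. partial_equivalence n (\<Phi> n)"
    and step: "\<And>n. \<exists>h. \<Phi> (Suc n) = (\<Phi> n)(Suc n := h)"
    using dependent_nat_choice[of partial_equivalence "\<lambda>n \<phi> \<phi>'. \<exists>h. \<phi>' = \<phi>(Suc n := h)"]
      partial_equivalence_0 partial_equivalence_Suc[OF char H] by metis
  have stable: "\<Phi> (n + m) k = \<Phi> n k" if "k \<le> n" for n m k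
  proof (induction m)
    case (Suc m)
    then show ?case using step[of "n + m"] that by auto
  qed simp
  \<comment> \<open>The diagonal is the limit: entry \<open>n\<close> no longer changes from stage
    \<open>n\<close> on.\<close>
  define \<phi> where "\<phi> n = \<Phi> n n" for n
  have agree: "\<phi> i = \<Phi> n i" if "i \<le> n" for i n
    using stable[of i i "n - i"] that by (simp add: \<phi>_def)
  have C1: "\<phi> i \<in> C1" for i
    using \<Phi>[of i] by (simp add: \<phi>_def partial_equivalence_def)
  have zero: "\<phi> 0 = id"
    using \<Phi>[of 0] by (simp add: \<phi>_def partial_equivalence_def)
  have "defect_br_coeff f \<phi> n = (\<lambda>_ _. 0)" "defect_tr_coeff g \<phi> n = (\<lambda>_ _ _. 0)" for n
    using defect_br_coeff_cong[of n \<phi> "\<Phi> n" f] defect_tr_coeff_cong[of n \<phi> "\<Phi> n" g] agree \<Phi>[of n]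
    by (simp_all add: partial_equivalence_def)
  note hom = vanishing_defects_imp_hom[OF C1 zero this]
  have lin: "\<And>i. module_hom scale scale (\<phi> i)" and equi: "\<And>i. equivariant1 (\<phi> i)"
    using C1 by (auto simp: C1_def)
  show ?thesis
    unfolding trivial_deformation_def equivalent_deformations_def
    using lin equi zero hom module_hom_fps_ext1[of \<phi>, OF lin] bij_fps_ext1[of \<phi>, OF zero]
    by (intro exI[of _ \<phi>]) simp
qed

end

end

theorem theorem5p6:
  fixes scale :: "'k::alg_closed_field \<Rightarrow> 'l::ab_group_add \<Rightarrow> 'l"
    and br :: "'l \<Rightarrow> 'l \<Rightarrow> 'l"
    and tr :: "'l \<Rightarrow> 'l \<Rightarrow> 'l \<Rightarrow> 'l"
    and G :: "('g, 'm) monoid_scheme"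
    and act :: "'g \<Rightarrow> 'l \<Rightarrow> 'l"
  assumes "CHAR('k) \<noteq> 2" and "CHAR('k) \<noteq> 3"
    and "equivariant_lie_yamaguti scale br tr G act"
    and "equivariant_lie_yamaguti.H23 scale br tr G act =
           {equivariant_lie_yamaguti.H23_zero scale br tr G act}"
  shows "equivariant_lie_yamaguti.equivariantly_rigid scale br tr G act"
proof -
  interpret equivariant_lie_yamaguti scale br tr G act by fact
  show ?thesis
    unfolding equivariantly_rigid_def using deformation_trivial assms(1,4) by blast
qed

end
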